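(* Let $r\ge0$ and let $\{a_j\}_{j=0}^\infty$ be a sequence of complex numbers. Let $\Psi_{r,1}(t)=t/\log^r(t+e)$, $t\ge0$. The following are equivalent: (1) the lacunary trigonometric series $\sum_{j=0}^\infty a_je^{i2\pi2^j\theta}$, $\theta\in[0,1)$, is the Fourier series of a function in $BMOA(\rho_{\Psi_{r,1}})(\mathbb{T})$; (2) $$\sup_{N\in\mathbb{N}}\Big\{\Big(\frac{\Psi_{r,1}^{-1}(N)}{N}\Big)^2\sum_{j\ge\log N}|a_j|^2\Big\}<\infty.$$
   Context: Functions on $\mathbb{T}$ are identified with $1$-periodic functions; $|I|\in(0,1]$ is the length of the arc $I$ normalised so that $|\mathbb{T}|=1$; $\langle u\rangle_I$ is the average of $u$ over $I$; $\mathbb{N}=\{1,2,\dots\}$. For an increasing bijection $\Psi$ of $[0,\infty)$ put $\rho_\Psi(t)=t^{-1}/\Psi^{-1}(t^{-1})$, $t>0$. $BMO(\rho_\Psi)(\mathbb{T})$ is the set of $u\in L^2(\mathbb{T})$ with $$\sup_{I\text{ arc}}\frac{1}{[\rho_\Psi(|I|)]^2|I|}\int_I|u(e^{2\pi i\theta})-\langle u\rangle_I|^2\,d\theta<\infty.$$ $BMOA(\rho_\Psi)(\mathbb{T})$ is the set of $u\in BMO(\rho_\Psi)(\mathbb{T})$ that are boundary values of holomorphic functions on the unit disc, i.e. $\widehat u(n)=0$ for $n<0$. Convention: if $r$ is so large that $t/\log^r(t+e)$ is not strictly increasing, $e$ is replaced by a fixed constant $c_r>e$ for which it is strictly increasing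 (in all cases $\Psi_{r,1}^{-1}(t)\approx_r t\log^r(t+e)$). *)

theory Defs
  imports "HOL-Analysis.Analysis"
begin

text \<open>
  Functions on the circle are 1-periodic functions on the real line, and the arc of normalised
  length \<open>l\<close> starting at \<open>exp (2 \<pi> i \<alpha>)\<close> is represented by the interval \<open>[\<alpha>, \<alpha> + l]\<close>.
\<close>

definition L2_circle :: "(real \<Rightarrow> complex) set" where
  "L2_circle = {u. u \<in> borel_measurable lebesgue \<and> (\<forall>\<theta>. u (\<theta> + 1) = u \<theta>) \<and>
     set_integrable lebesgue {0..1} (\<lambda>\<theta>. (cmod (u \<theta>))\<^sup>2)}"

definition fourier_coeff :: "(real \<Rightarrow> complex) \<Rightarrow> int \<Rightarrow> complex" where
  "fourier_coeff u n = (LINT \<theta>:{0..1}|lebesgue. u \<theta> * cis (- 2 * pi * of_int n * \<theta>))"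

definition arc_avg :: "(real \<Rightarrow> complex) \<Rightarrow> real \<Rightarrow> real \<Rightarrow> complex" where
  "arc_avg u \<alpha> l = (LINT \<theta>:{\<alpha>..\<alpha> + l}|lebesgue. u \<theta>) / of_real l"

definition Psi_inv :: "(real \<Rightarrow> real) \<Rightarrow> real \<Rightarrow> real" where
  "Psi_inv \<Psi> = inv_into {0..} \<Psi>"

definition rho :: "(real \<Rightarrow> real) \<Rightarrow> real \<Rightarrow> real" where
  "rho \<Psi> t = inverse t / Psi_inv \<Psi> (inverse t)"

definition BMO :: "(real \<Rightarrow> real) \<Rightarrow> (real \<Rightarrow> complex) set" where
  "BMO \<rho> = {u \<in> L2_circle. bdd_above
     {1 / ((\<rho> l)\<^sup>2 * l) * (LINT \<theta>:{\<alpha>..\<alpha> + l}|lebesgue. (cmod (u \<theta> - arc_avg u \<alpha> l))\<^sup>2) | \<alpha> l.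
        0 < l \<and> l \<le> 1}}"

definition BMOA :: "(real \<Rightarrow> real) \<Rightarrow> (real \<Rightarrow> complex) set" where
  "BMOA \<rho> = {u \<in> BMO \<rho>. \<forall>n<0. fourier_coeff u n = 0}"

definition Psi :: "real \<Rightarrow> real \<Rightarrow> real \<Rightarrow> real" where
  "Psi c r t = t / ln (t + c) powr r"

text \<open>
  The shift is \<open>e\<close> whenever this makes \<open>Psi\<close> strictly increasing; otherwise it is any larger
  constant that does.
\<close>

definition admissible_shift :: "real \<Rightarrow> real \<Rightarrow> bool" where
  "admissible_shift r c \<longleftrightarrow>
     (if strict_mono_on {0..} (Psi (exp 1) r) then c = exp 1
      else c > exp 1 \<and> strict_mono_on {0..} (Psi c r))"

text \<open>
  The coefficient at frequency \<open>n\<close> of the series with coefficient \<open>a j\<close> at frequency \<open>2 ^ j\<close>;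
  the index set has at most one element.
\<close>

definition lacunary_coeff :: "(nat \<Rightarrow> complex) \<Rightarrow> int \<Rightarrow> complex" where
  "lacunary_coeff a n = (\<Sum>j | n = 2 ^ j. a j)"

definition is_fourier_series_of :: "(int \<Rightarrow> complex) \<Rightarrow> (real \<Rightarrow> complex) \<Rightarrow> bool" where
  "is_fourier_series_of c u \<longleftrightarrow> (\<forall>n. fourier_coeff u n = c n)"

end

theory Submission
  imports Defs "HOL-Real_Asymp.Real_Asymp"
begin

text \<open>
  Write \<open>g t = Psi_inv (Psi c r) t / t\<close>, so that \<open>rho (Psi c r) l = 1 / g (1 / l)\<close>. Since \<open>g\<close> grows
  like \<open>(1 + ln t) powr r\<close>, passing from \<open>t\<close> to a power of \<open>t\<close> changes \<open>g\<close> by at most a constant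
  factor. Hence it makes no difference whether the tails of the coefficients are cut at \<open>ln N\<close> or
  at the binary logarithm of \<open>N\<close>, and both sides of the equivalence turn out to say the same thing
  (\<open>tail_decay\<close>): the energy of the coefficients of index at least \<open>m\<close> is
  \<open>O((1 + m) powr (- 2 * r))\<close>.

  The link between oscillation and coefficients is that \<open>cis (2 * pi * 2 ^ j * \<theta>)\<close> with \<open>j \<ge> m\<close>
  has period \<open>1 / 2 ^ m\<close>. On every arc of that length the terms of index at least \<open>m\<close> are therefore
  orthogonal to one another and to the constants, and the mean square of such a sum over the arc is
  exactly the energy of its coefficients.

  If \<open>u\<close> has bounded oscillation, cut the circle into \<open>2 ^ m\<close> arcs of length \<open>1 / 2 ^ m\<close> and pair
  \<open>u\<close> with a finite piece \<open>P\<close> of its series of index at least \<open>m\<close>. On each arc the mean of \<open>u\<close> can be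
  subtracted without changing the pairing, because \<open>P\<close> has mean zero there; summing over the arcs
  bounds the energy of \<open>P\<close> by the mean square oscillation of \<open>u\<close> at scale \<open>1 / 2 ^ m\<close>
  (\<open>tail_energy_le_dyadic_oscillation\<close>).

  If conversely the tails decay, the series converges to a function \<open>u\<close>, almost everywhere
  along a subsequence (\<open>lacunary_riesz_fischer\<close>). On an arc of length \<open>l\<close> with \<open>1 / l\<close> between
  \<open>2 ^ m\<close> and \<open>2 ^ (m + 1)\<close>, compare \<open>u\<close> with the value at an end point of the sum of the terms of
  index below \<open>m\<close>: these terms vary little by their Lipschitz bounds, and the rest has small mean
  square by periodicity. The estimate is carried out for the partial sums
  (\<open>partial_sum_oscillation_le\<close>) and passes to \<open>u\<close> by Fatou's lemma.
\<close>

section \<open>The growth of the inverse of the growth function\<close>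

text \<open>
  By the intermediate value theorem \<open>Psi c r\<close> maps onto the half-line, as it vanishes at \<open>0\<close> and
  tends to infinity. Hence \<open>Psi_inv\<close>, which is a choice of preimages, is a right inverse.
\<close>

lemma Psi_Psi_inv:
  assumes c: "exp 1 \<le> c" and y: "0 \<le> y"
  shows "0 \<le> Psi_inv (Psi c r) y" "Psi c r (Psi_inv (Psi c r) y) = y"
proof -
  have c1: "1 < t + c" if "0 \<le> t" for t
    using c that exp_gt_one[of "1::real"] by linarith
  then have c1': "t + c \<noteq> 0" "ln (t + c) \<noteq> 0" if "0 \<le> t" for t
    using that by (smt (verit) ln_gt_zero)+
  have "filterlim (\<lambda>t. t / ln (t + c) powr r) at_top at_top" by real_asymp
  then have "eventually (\<lambda>t. y \<le> Psi c r t) at_top"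
    by (simp add: filterlim_at_top Psi_def)
  then obtain S where S: "\<And>t. t \<ge> S \<Longrightarrow> y \<le> Psi c r t"
    by (auto simp: eventually_at_top_linorder)
  have "continuous_on {0..max S 0} (Psi c r)"
    unfolding Psi_def using c1' by (intro continuous_intros) auto
  moreover have "Psi c r 0 \<le> y" using y by (simp add: Psi_def)
  ultimately obtain t where "0 \<le> t" "Psi c r t = y"
    using IVT'[of "Psi c r" 0 y "max S 0"] S[of "max S 0"] by auto
  then have "y \<in> Psi c r ` {0..}" by force
  then show "0 \<le> Psi_inv (Psi c r) y" "Psi c r (Psi_inv (Psi c r) y) = y"
    using inv_into_into[of y "Psi c r" "{0..}"] f_inv_into_f[of y "Psi c r" "{0..}"]
    by (simp_all add: Psi_inv_def)
qed

text \<open>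
  With \<open>s = Psi_inv (Psi c r) t\<close> the ratio \<open>s / t\<close> equals \<open>ln (s + c) powr r\<close>, so that only \<open>ln s\<close>
  and \<open>ln t\<close> have to be compared. The lower bound comes from \<open>s \<ge> t\<close>. For the upper bound, a power
  of a logarithm grows more slowly than a square root, so that \<open>s\<close> is at most a constant multiple of
  \<open>t\<^sup>2\<close>.
\<close>

lemma Psi_inv_ratio_bounds:
  assumes r: "0 \<le> r" and c: "exp 1 \<le> c"
  shows "\<exists>A>0. \<exists>B>0. \<forall>t\<ge>1. A * (1 + ln t) powr r \<le> Psi_inv (Psi c r) t / t \<and>
           Psi_inv (Psi c r) t / t \<le> B * (1 + ln t) powr r"
proof -
  define C where "C = (2 * r + 1) powr (2 * r + 1) * (1 + c)\<^sup>2"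
  have c1: "1 < c" using c exp_gt_one[of "1::real"] by linarith
  have C: "0 < C" using r c1 by (simp add: C_def)
  define B where "B = \<bar>ln C\<bar> + 2"
  have B: "0 < B" by (simp add: B_def)
  have bounds: "(1 / 2) powr r * (1 + ln t) powr r \<le> Psi_inv (Psi c r) t / t
      \<and> Psi_inv (Psi c r) t / t \<le> B powr r * (1 + ln t) powr r" if t: "1 \<le> t" for t
  proof -
    define s where "s = Psi_inv (Psi c r) t"
    define L where "L = ln (s + c)"
    have s0: "0 \<le> s" and eq: "s / L powr r = t"
      using Psi_Psi_inv[OF c, of t r] t by (simp_all add: s_def L_def Psi_def)
    have L1: "1 \<le> L"
    proof -
      have "ln (exp 1) \<le> L" unfolding L_def using c c1 s0 by (intro ln_mono) auto
      then show ?thesis by simp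
    qed
    have Lr1: "1 \<le> L powr r" using L1 r ge_one_powr_ge_zero by blast
    have st: "s = t * L powr r" using eq L1 by (auto simp: field_simps)
    have "t * 1 \<le> s" unfolding st using Lr1 t by (intro mult_left_mono) auto
    then have ts: "t \<le> s" by simp
    have ratio: "s / t = L powr r" using st t by simp
    have "1 + ln t \<le> 2 * L"
    proof -
      have "ln t \<le> L" unfolding L_def using ts t c1 by (intro ln_mono) auto
      with L1 show ?thesis by simp
    qed
    then have "((1 + ln t) / 2) powr r \<le> L powr r"
      using t r by (intro powr_mono2) auto
    then have lower: "(1 / 2) powr r * (1 + ln t) powr r \<le> s / t"
      using t by (simp add: ratio powr_divide)
    have sc: "s + c \<le> (1 + c) * s"
    proof -
      have "c * 1 \<le> c * s" using ts t c1 by (intro mult_left_mono) auto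
      then show ?thesis by (simp add: algebra_simps)
    qed
    \<comment> \<open>The exponent is raised to \<open>2 * r + 1\<close> because comparing a power of \<open>ln\<close> with a linear
      function needs a positive exponent, also when \<open>r = 0\<close>.\<close>
    have "s\<^sup>2 = t\<^sup>2 * L powr (2 * r)"
      by (simp add: st power_mult_distrib power2_eq_square powr_add[symmetric])
    also have "\<dots> \<le> t\<^sup>2 * L powr (2 * r + 1)"
      using L1 by (intro mult_left_mono powr_mono) auto
    also have "\<dots> \<le> t\<^sup>2 * ((2 * r + 1) powr (2 * r + 1) * (s + c))"
      unfolding L_def using r s0 c1 by (intro mult_left_mono ln_powr_bound2) auto
    also have "\<dots> \<le> t\<^sup>2 * ((2 * r + 1) powr (2 * r + 1) * ((1 + c) * s))"
      by (intro mult_left_mono sc) auto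
    finally have "s * s \<le> (t\<^sup>2 * ((2 * r + 1) powr (2 * r + 1) * (1 + c))) * s"
      by (simp add: power2_eq_square mult_ac)
    then have sle: "s \<le> t\<^sup>2 * ((2 * r + 1) powr (2 * r + 1) * (1 + c))"
      using ts t by (intro mult_right_le_imp_le[of s s]) auto
    have "s + c \<le> (1 + c) * s" by (rule sc)
    also have "\<dots> \<le> (1 + c) * (t\<^sup>2 * ((2 * r + 1) powr (2 * r + 1) * (1 + c)))"
      using sle c1 by (intro mult_left_mono) auto
    also have "\<dots> = C * t\<^sup>2" by (simp add: C_def power2_eq_square mult_ac)
    finally have "L \<le> ln (C * t\<^sup>2)" unfolding L_def using s0 c1 by (intro ln_mono) auto
    also have "\<dots> = ln C + 2 * ln t" using C t by (simp add: ln_mult ln_realpow)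
    also have "\<dots> \<le> B * (1 + ln t)"
    proof -
      have "0 \<le> \<bar>ln C\<bar> * ln t" using t by simp
      then show ?thesis by (simp add: B_def algebra_simps)
    qed
    finally have "L powr r \<le> (B * (1 + ln t)) powr r"
      using L1 r by (intro powr_mono2) auto
    then have "s / t \<le> B powr r * (1 + ln t) powr r"
      using ratio by (simp add: powr_mult)
    with lower show ?thesis by (simp add: s_def)
  qed
  have "0 < B powr r" using B by simp
  with bounds show ?thesis
    by (intro exI[of _ "(1 / 2) powr r"] exI[of _ "B powr r"] conjI[of "_ < _"] allI impI) simp_all
qed

text \<open>
  The bounds in the form in which both scales of the problem meet: arcs of length \<open>1 / 2 ^ m\<close> need the
  lower bound at \<open>2 ^ m\<close>, while cutting the tails at \<open>ln t\<close> needs the upper bound for all \<open>t\<close> up to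
  \<open>exp m\<close>.
\<close>

lemma Psi_inv_ratio_dyadic:
  assumes r: "0 \<le> r" and c: "exp 1 \<le> c"
  shows "\<exists>A>0. \<exists>B>0.
     (\<forall>m::nat. A * (1 + real m) powr r \<le> Psi_inv (Psi c r) (2 ^ m) / 2 ^ m) \<and>
     (\<forall>m::nat. \<forall>t\<ge>1. ln t \<le> real m \<longrightarrow> Psi_inv (Psi c r) t / t \<le> B * (1 + real m) powr r)"
proof -
  obtain A B where A: "0 < A" and B: "0 < B"
    and bounds: "\<forall>t\<ge>1. A * (1 + ln t) powr r \<le> Psi_inv (Psi c r) t / t \<and>
           Psi_inv (Psi c r) t / t \<le> B * (1 + ln t) powr r"
    using Psi_inv_ratio_bounds[OF r c] by (elim exE conjE)
  have "A * (1 / 2) powr r * (1 + real m) powr r \<le> Psi_inv (Psi c r) (2 ^ m) / 2 ^ m" for m :: nat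
  proof -
    have "real m * (1 / 2) \<le> real m * ln 2" using ln2_ge_two_thirds by (intro mult_left_mono) auto
    then have "(1 + real m) / 2 \<le> 1 + ln (2 ^ m)" by (simp add: ln_realpow)
    then have "((1 + real m) / 2) powr r \<le> (1 + ln (2 ^ m)) powr r"
      using r by (intro powr_mono2) auto
    then have "A * ((1 + real m) / 2) powr r \<le> A * (1 + ln (2 ^ m)) powr r"
      using A by (intro mult_left_mono) auto
    also have "\<dots> \<le> Psi_inv (Psi c r) (2 ^ m) / 2 ^ m" using bounds by simp
    finally show ?thesis by (simp add: powr_divide)
  qed
  moreover have "Psi_inv (Psi c r) t / t \<le> B * (1 + real m) powr r"
    if "1 \<le> t" "ln t \<le> real m" for t and m :: nat
  proof -
    have "Psi_inv (Psi c r) t / t \<le> B * (1 + ln t) powr r" using bounds that by simp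
    also have "\<dots> \<le> B * (1 + real m) powr r"
      using that B r by (intro mult_left_mono powr_mono2) auto
    finally show ?thesis .
  qed
  moreover have "0 < A * (1 / 2) powr r" using A by simp
  ultimately show ?thesis using B by blast
qed

section \<open>Polynomial decay of the tails\<close>

text \<open>
  The tails enter through their finite sections, so that convergence of the series is part of the
  condition.
\<close>

definition tail_decay :: "real \<Rightarrow> (nat \<Rightarrow> complex) \<Rightarrow> bool" where
  "tail_decay r a \<longleftrightarrow>
     (\<exists>K\<ge>0. \<forall>m n. ((1 + real m) powr r)\<^sup>2 * (\<Sum>j=m..<n. (cmod (a j))\<^sup>2) \<le> K)"

text \<open>
  Cutting at \<open>ln N\<close> for \<open>N = 2 ^ m\<close> keeps all indices from \<open>m\<close> on because \<open>ln 2 < 1\<close>, which gives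
  the decay of the tails. Conversely the indices beyond \<open>ln N\<close> are those from the
  next integer \<open>m\<close> on, and the weight at \<open>N\<close> is controlled by that \<open>m\<close>.
\<close>

lemma weighted_tails_finite_iff_tail_decay:
  assumes r: "0 \<le> r" and c: "exp 1 \<le> c"
  shows "(SUP N\<in>{1::nat..}. ennreal ((Psi_inv (Psi c r) (real N) / real N)\<^sup>2) *
       (\<Sum>\<^sub>\<infinity>j\<in>{j::nat. ln (real N) \<le> real j}. ennreal ((cmod (a j))\<^sup>2))) < \<infinity>
     \<longleftrightarrow> tail_decay r a"
    (is "(SUP N\<in>_. ennreal ((?g N)\<^sup>2) * ?S N) < \<infinity> \<longleftrightarrow> _")
proof -
  obtain A B where A: "0 < A" and B: "0 < B"
    and bounds: "\<forall>m::nat. A * (1 + real m) powr r \<le> Psi_inv (Psi c r) (2 ^ m) / 2 ^ m"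
      "\<forall>m::nat. \<forall>t\<ge>1. ln t \<le> real m \<longrightarrow> Psi_inv (Psi c r) t / t \<le> B * (1 + real m) powr r"
    using Psi_inv_ratio_dyadic[OF r c] by (elim exE conjE)
  show ?thesis
  proof
    assume fin: "(SUP N\<in>{1::nat..}. ennreal ((?g N)\<^sup>2) * ?S N) < \<infinity>"
    then obtain K where K: "0 \<le> K" "(SUP N\<in>{1::nat..}. ennreal ((?g N)\<^sup>2) * ?S N) = ennreal K"
      by (auto simp: less_top_ennreal)
    have "((1 + real m) powr r)\<^sup>2 * (\<Sum>j=m..<n. (cmod (a j))\<^sup>2)
        \<le> K / A\<^sup>2" for m n
    proof -
      let ?s = "\<Sum>j=m..<n. (cmod (a j))\<^sup>2"
      let ?N = "2 ^ m :: nat"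
      have s0: "0 \<le> ?s" by (simp add: sum_nonneg)
      have "ennreal ?s = (\<Sum>j=m..<n. ennreal ((cmod (a j))\<^sup>2))"
        by (simp add: sum_ennreal)
      also have "\<dots> = (\<Sum>\<^sub>\<infinity>j\<in>{m..<n}. ennreal ((cmod (a j))\<^sup>2))" by simp
      also have "\<dots> \<le> ?S ?N"
      proof (rule infsum_mono_neutral)
        show "ennreal ((cmod (a j))\<^sup>2) \<le> 0"
          if "j \<in> {m..<n} - {j. ln (real ?N) \<le> real j}" for j
        proof -
          have "real m * ln 2 \<le> real m * 1" using ln_2_less_1 by (intro mult_left_mono) auto
          with that show ?thesis by (auto simp: ln_realpow)
        qed
      qed (auto intro: nonneg_summable_on_complete)
      finally have "ennreal ((?g ?N)\<^sup>2) * ennreal ?s \<le> ennreal ((?g ?N)\<^sup>2) * ?S ?N"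
        by (intro mult_left_mono) auto
      also have "\<dots> \<le> ennreal K" unfolding K(2)[symmetric]
        by (rule SUP_upper) auto
      finally have 1: "(?g ?N)\<^sup>2 * ?s \<le> K"
        using K(1) s0 by (simp add: ennreal_mult[symmetric])
      have "A * (1 + real m) powr r \<le> ?g ?N" using bounds(1) by simp
      then have "(A * (1 + real m) powr r)\<^sup>2 * ?s \<le> (?g ?N)\<^sup>2 * ?s"
        using A s0 by (intro mult_right_mono power_mono) auto
      with 1 have "(A * (1 + real m) powr r)\<^sup>2 * ?s \<le> K" by linarith
      then show ?thesis using A by (simp add: field_simps power_mult_distrib)
    qed
    moreover have "0 \<le> K / A\<^sup>2" using K(1) by simp
    ultimately show "tail_decay r a" unfolding tail_decay_def by blast
  next
    assume "tail_decay r a"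
    then obtain K where K: "0 \<le> K"
      "\<And>m n. ((1 + real m) powr r)\<^sup>2 * (\<Sum>j=m..<n. (cmod (a j))\<^sup>2) \<le> K"
      unfolding tail_decay_def by blast
    have "ennreal ((?g N)\<^sup>2) * ?S N \<le> ennreal (B\<^sup>2 * K)" if N: "1 \<le> N" for N :: nat
    proof -
      define m where "m = nat \<lceil>ln (real N)\<rceil>"
      let ?w = "(1 + real m) powr r"
      have w: "0 < ?w" by simp
      have "?S N \<le> ennreal (K / ?w\<^sup>2)"
        unfolding nonneg_infsum_complete[OF zero_le]
      proof (rule SUP_least)
        fix F assume "F \<in> {F. finite F \<and> F \<subseteq> {j. ln (real N) \<le> real j}}"
        then have F: "finite F" "\<And>j. j \<in> F \<Longrightarrow> ln (real N) \<le> real j" by auto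
        have sub: "F \<subseteq> {m..<Suc (Max F)}"
        proof
          fix j assume j: "j \<in> F"
          have "m \<le> j" unfolding m_def using F(2)[OF j] by linarith
          with j F(1) show "j \<in> {m..<Suc (Max F)}" by (simp add: less_Suc_eq_le)
        qed
        have "(\<Sum>j\<in>F. (cmod (a j))\<^sup>2) \<le> (\<Sum>j=m..<Suc (Max F). (cmod (a j))\<^sup>2)"
          using sub by (intro sum_mono2) auto
        also have "\<dots> \<le> K / ?w\<^sup>2" using K(2)[of m "Suc (Max F)"] w
          by (simp add: field_simps)
        finally show "(\<Sum>j\<in>F. ennreal ((cmod (a j))\<^sup>2)) \<le> ennreal (K / ?w\<^sup>2)"
          by (simp add: sum_ennreal ennreal_leI)
      qed
      then have "ennreal ((?g N)\<^sup>2) * ?S N \<le> ennreal ((?g N)\<^sup>2) * ennreal (K / ?w\<^sup>2)"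
        by (intro mult_left_mono) auto
      also have "\<dots> = ennreal ((?g N)\<^sup>2 * (K / ?w\<^sup>2))"
        using K(1) by (intro ennreal_mult[symmetric]) auto
      also have "\<dots> \<le> ennreal (B\<^sup>2 * K)"
      proof (rule ennreal_leI)
        have "ln (real N) \<le> real m" using N by (simp add: m_def)
        then have "?g N \<le> B * ?w" using bounds(2) N by simp
        moreover have "0 \<le> ?g N"
          using Psi_Psi_inv(1)[OF c] by simp
        ultimately have "(?g N)\<^sup>2 \<le> (B * ?w)\<^sup>2" by (intro power_mono)
        then have "(?g N)\<^sup>2 * (K / ?w\<^sup>2) \<le> (B * ?w)\<^sup>2 * (K / ?w\<^sup>2)"
          using K(1) by (intro mult_right_mono) auto
        also have "\<dots> = B\<^sup>2 * K" using w by (simp add: power_mult_distrib)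
        finally show "(?g N)\<^sup>2 * (K / ?w\<^sup>2) \<le> B\<^sup>2 * K" .
      qed
      finally show ?thesis .
    qed
    then have "(SUP N\<in>{1::nat..}. ennreal ((?g N)\<^sup>2) * ?S N) \<le> ennreal (B\<^sup>2 * K)"
      by (intro SUP_least) auto
    also have "\<dots> < \<infinity>" by simp
    finally show "(SUP N\<in>{1::nat..}. ennreal ((?g N)\<^sup>2) * ?S N) < \<infinity>" .
  qed
qed

section \<open>Mean values and square integrals on a finite measure space\<close>

lemma (in finite_measure) integrable_if_square_integrable:
  fixes f :: "'a \<Rightarrow> complex"
  assumes [measurable]: "f \<in> borel_measurable M" and sq: "integrable M (\<lambda>x. (cmod (f x))\<^sup>2)"
  shows "integrable M f"
proof (rule Bochner_Integration.integrable_bound[of M "\<lambda>x. 1 + (cmod (f x))\<^sup>2"])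
  have "t \<le> 1 + t\<^sup>2" for t :: real
    using zero_le_power2[of "t - 1 / 2"] by (simp add: power2_eq_square algebra_simps)
  then show "AE x in M. cmod (f x) \<le> norm (1 + (cmod (f x))\<^sup>2)" by (simp add: abs_of_nonneg)
qed (use sq in auto)

lemma (in finite_measure) square_integrable_diff_const:
  fixes f :: "'a \<Rightarrow> complex"
  assumes [measurable]: "f \<in> borel_measurable M" and sq: "integrable M (\<lambda>x. (cmod (f x))\<^sup>2)"
  shows "integrable M (\<lambda>x. (cmod (f x - z))\<^sup>2)"
proof (rule Bochner_Integration.integrable_bound[of M "\<lambda>x. 2 * (cmod (f x))\<^sup>2 + 2 * (cmod z)\<^sup>2"])
  show "AE x in M. norm ((cmod (f x - z))\<^sup>2) \<le> norm (2 * (cmod (f x))\<^sup>2 + 2 * (cmod z)\<^sup>2)"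
  proof (rule AE_I2)
    fix x
    have "(cmod (f x - z))\<^sup>2 \<le> (cmod (f x) + cmod z)\<^sup>2"
      by (intro power_mono norm_triangle_ineq4) auto
    also have "\<dots> \<le> 2 * (cmod (f x))\<^sup>2 + 2 * (cmod z)\<^sup>2"
      using zero_le_power2[of "cmod (f x) - cmod z"] by (simp add: power2_eq_square algebra_simps)
    finally show "norm ((cmod (f x - z))\<^sup>2) \<le> norm (2 * (cmod (f x))\<^sup>2 + 2 * (cmod z)\<^sup>2)"
      by simp
  qed
qed (use sq in auto)

text \<open>
  Pythagoras: the deviation of \<open>f\<close> from its mean is orthogonal to the constants.
\<close>

lemma (in finite_measure) mean_minimises_square_deviation:
  fixes f :: "'a \<Rightarrow> complex"
  assumes [measurable]: "f \<in> borel_measurable M" and sq: "integrable M (\<lambda>x. (cmod (f x))\<^sup>2)"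
    and pos: "0 < measure M (space M)"
  shows "(LINT x|M. (cmod (f x - (LINT x|M. f x) / of_real (measure M (space M))))\<^sup>2)
      \<le> (LINT x|M. (cmod (f x - z))\<^sup>2)"
proof -
  define w where "w = (LINT x|M. f x) / of_real (measure M (space M))"
  have f: "integrable M f" using integrable_if_square_integrable[OF assms(1,2)] .
  have "(LINT x|M. f x - w) = 0"
    using f pos by (simp add: w_def scaleR_conv_of_real)
  then have orth: "(LINT x|M. Re ((f x - w) * cnj (w - z))) = 0"
    using f by (subst integral_Re) auto
  have "(cmod (f x - z))\<^sup>2 = (cmod (f x - w))\<^sup>2 + 2 * Re ((f x - w) * cnj (w - z)) + (cmod (w - z))\<^sup>2" for x
    unfolding cmod_power2 by (simp add: power2_eq_square algebra_simps)
  then have "(LINT x|M. (cmod (f x - z))\<^sup>2) = (LINT x|M. (cmod (f x - w))\<^sup>2)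
      + 2 * (LINT x|M. Re ((f x - w) * cnj (w - z))) + measure M (space M) * (cmod (w - z))\<^sup>2"
    using f square_integrable_diff_const[OF assms(1,2)] by simp
  with orth show ?thesis by (simp add: w_def)
qed

text \<open>
  Orthogonality of \<open>p\<close> to the constants allows \<open>f\<close> to be shifted by \<open>z\<close> in the pairing. Expanding the
  square of \<open>f - z - p\<close> replaces the Cauchy-Schwarz inequality and gives a bound that
  can be summed over arcs without any square roots.
\<close>

lemma (in finite_measure) pairing_with_mean_zero_le:
  fixes f p :: "'a \<Rightarrow> complex"
  assumes [measurable]: "f \<in> borel_measurable M" "p \<in> borel_measurable M"
    and sq: "integrable M (\<lambda>x. (cmod (f x))\<^sup>2)" and p: "integrable M p" "integrable M (\<lambda>x. f x * cnj (p x))"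
      "integrable M (\<lambda>x. (cmod (p x))\<^sup>2)"
    and mean: "(LINT x|M. p x) = 0"
  shows "2 * Re (LINT x|M. f x * cnj (p x))
     \<le> (LINT x|M. (cmod (f x - z))\<^sup>2) + (LINT x|M. (cmod (p x))\<^sup>2)"
proof -
  have "(LINT x|M. (f x - z) * cnj (p x)) = (LINT x|M. f x * cnj (p x) - z * cnj (p x))"
    by (simp add: algebra_simps)
  also have "\<dots> = (LINT x|M. f x * cnj (p x))" using p mean by simp
  finally have "2 * Re (LINT x|M. f x * cnj (p x)) = 2 * Re (LINT x|M. (f x - z) * cnj (p x))" by simp
  also have "\<dots> = (LINT x|M. 2 * Re ((f x - z) * cnj (p x)))"
    using p by (subst integral_mult_right_zero, subst integral_Re) (simp_all add: left_diff_distrib)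
  also have "\<dots> \<le> (LINT x|M. (cmod (f x - z))\<^sup>2 + (cmod (p x))\<^sup>2)"
  proof (rule integral_mono)
    show "2 * Re ((f x - z) * cnj (p x)) \<le> (cmod (f x - z))\<^sup>2 + (cmod (p x))\<^sup>2" for x
    proof -
      have "(cmod (f x - z - p x))\<^sup>2 =
          (cmod (f x - z))\<^sup>2 + (cmod (p x))\<^sup>2 - 2 * Re ((f x - z) * cnj (p x))"
        unfolding cmod_power2 by (simp add: power2_eq_square algebra_simps)
      then show ?thesis using zero_le_power2[of "cmod (f x - z - p x)"] by linarith
    qed
    show "integrable M (\<lambda>x. 2 * Re ((f x - z) * cnj (p x)))"
      using p by (intro integrable_mult_right integrable_Re) (simp add: left_diff_distrib)
  qed (use p square_integrable_diff_const[OF assms(1) sq] in auto)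
  finally show ?thesis using p square_integrable_diff_const[OF assms(1) sq] by simp
qed

lemma integral_split_equal_intervals:
  fixes f :: "real \<Rightarrow> complex"
  assumes h: "0 \<le> h" and f: "integrable (lebesgue_on {0..real n * h}) f"
  shows "integral\<^sup>L (lebesgue_on {0..real n * h}) f
    = (\<Sum>k<n. integral\<^sup>L (lebesgue_on {real k * h..real k * h + h}) f)"
  using f
proof (induction n)
  case (Suc n)
  have sub: "{0..real n * h} \<subseteq> {0..real (Suc n) * h}"
    "{real n * h..real n * h + h} \<subseteq> {0..real (Suc n) * h}"
    using h by (auto simp: algebra_simps)
  have int: "integrable (lebesgue_on {0..real n * h}) f"
    "integrable (lebesgue_on {real n * h..real n * h + h}) f"
    by (rule integrable_subinterval[OF Suc.prems sub(1)] integrable_subinterval[OF Suc.prems sub(2)])+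
  have "integral {0..real n * h} f + integral {real n * h..real (Suc n) * h} f
      = integral {0..real (Suc n) * h} f"
    using h Suc.prems
    by (intro Henstock_Kurzweil_Integration.integral_combine integrable_on_lebesgue_on)
       (auto simp: algebra_simps)
  then show ?case using Suc int
    by (simp add: lebesgue_integral_eq_integral algebra_simps)
qed (simp add: lebesgue_integral_eq_integral)

section \<open>Trigonometric sums with dyadic frequencies\<close>

text \<open>
  The interval contains a whole number of periods, so that the primitive of the exponential takes
  the same value at both ends.
\<close>

lemma integral_cis_full_periods:
  fixes q \<alpha> h :: real
  assumes "q * h \<in> \<int>" "0 \<le> h"
  shows "integral\<^sup>L (lebesgue_on {\<alpha>..\<alpha> + h}) (\<lambda>\<theta>. cis (2 * pi * q * \<theta>))
    = (if q = 0 then of_real h else 0)"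
proof (cases "q = 0")
  case True
  with assms show ?thesis by (simp add: scaleR_conv_of_real measure_restrict_space)
next
  case False
  let ?F = "\<lambda>\<theta>. cis (2 * pi * q * \<theta>) / (2 * pi * q * \<i>)"
  have "((\<lambda>\<theta>. cis (2 * pi * q * \<theta>)) has_integral (?F (\<alpha> + h) - ?F \<alpha>)) {\<alpha>..\<alpha> + h}"
  proof (rule fundamental_theorem_of_calculus)
    fix x :: real
    show "(?F has_vector_derivative cis (2 * pi * q * x)) (at x within {\<alpha>..\<alpha> + h})"
    proof -
      have "((\<lambda>z. exp (2 * pi * q * \<i> * z) / (2 * pi * q * \<i>)) has_field_derivative
          exp (2 * pi * q * \<i> * of_real x)) (at (of_real x))"
        using False by (auto intro!: derivative_eq_intros)
      from has_vector_derivative_real_field[OF this] show ?thesis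
        by (simp add: cis_conv_exp mult_ac)
    qed
  qed (use assms in auto)
  moreover have "cis (2 * pi * q * (\<alpha> + h)) = cis (2 * pi * q * \<alpha>)"
  proof -
    have "cis (2 * pi * q * (\<alpha> + h)) = cis (2 * pi * q * \<alpha>) * cis (2 * pi * (q * h))"
      by (simp add: cis_mult algebra_simps)
    then show ?thesis using cis_multiple_2pi[OF assms(1)] by simp
  qed
  ultimately have "((\<lambda>\<theta>. cis (2 * pi * q * \<theta>)) has_integral 0) {\<alpha>..\<alpha> + h}" by simp
  moreover have "integrable (lebesgue_on {\<alpha>..\<alpha> + h}) (\<lambda>\<theta>. cis (2 * pi * q * \<theta>))"
    by (intro continuous_imp_integrable_real continuous_intros)
  ultimately show ?thesis using False
    by (simp add: lebesgue_integral_eq_integral integral_unique)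
qed

definition lacunary_sum :: "(nat \<Rightarrow> complex) \<Rightarrow> nat set \<Rightarrow> real \<Rightarrow> complex" where
  "lacunary_sum a J \<theta> = (\<Sum>j\<in>J. a j * cis (2 * pi * 2 ^ j * \<theta>))"

lemma continuous_on_lacunary_sum [continuous_intros]: "continuous_on S (lacunary_sum a J)"
  unfolding lacunary_sum_def by (intro continuous_intros)

lemma lacunary_sum_periodic: "lacunary_sum a J (\<theta> + 1) = lacunary_sum a J \<theta>"
proof -
  have "cis (2 * pi * 2 ^ j * (\<theta> + 1)) = cis (2 * pi * 2 ^ j * \<theta>)" for j :: nat
  proof -
    have "cis (2 * pi * 2 ^ j * (\<theta> + 1)) = cis (2 * pi * 2 ^ j * \<theta>) * cis (2 * pi * 2 ^ j)"
      by (simp add: cis_mult algebra_simps)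
    moreover have "cis (2 * pi * 2 ^ j) = 1" by (rule cis_multiple_2pi) auto
    ultimately show ?thesis by simp
  qed
  then show ?thesis by (simp add: lacunary_sum_def)
qed

lemma integrable_cis [simp]:
  "integrable (lebesgue_on {a..b}) (\<lambda>\<theta>. cis (x * \<theta>))"
  by (intro continuous_imp_integrable_real continuous_intros)

lemma dyadic_frequency_Ints:
  assumes "m \<le> j"
  shows "(2::real) ^ j / 2 ^ m \<in> \<int>"
proof -
  have "(2::real) ^ j / 2 ^ m = 2 ^ (j - m)" using assms by (simp add: power_diff)
  then show ?thesis by simp
qed

lemma integral_lacunary_sum_dyadic:
  assumes J: "J \<subseteq> {m..}"
  shows "integral\<^sup>L (lebesgue_on {\<alpha>..\<alpha> + 1 / 2 ^ m}) (lacunary_sum a J) = 0"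
proof -
  have "integral\<^sup>L (lebesgue_on {\<alpha>..\<alpha> + 1 / 2 ^ m}) (lacunary_sum a J)
     = (\<Sum>j\<in>J. a j * integral\<^sup>L (lebesgue_on {\<alpha>..\<alpha> + 1 / 2 ^ m}) (\<lambda>\<theta>. cis (2 * pi * 2 ^ j * \<theta>)))"
    unfolding lacunary_sum_def by (subst Bochner_Integration.integral_sum) simp_all
  also have "\<dots> = 0"
    using J by (intro sum.neutral ballI) (subst integral_cis_full_periods, auto intro!: dyadic_frequency_Ints)
  finally show ?thesis .
qed

text \<open>
  Differences of frequencies \<open>2 ^ j\<close> with \<open>j \<ge> m\<close> are multiples of \<open>2 ^ m\<close>, hence the terms of the sum
  are orthogonal on every interval of length \<open>1 / 2 ^ m\<close>, not only on the whole circle.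
\<close>

lemma integral_square_lacunary_sum_dyadic:
  assumes J: "finite J" "J \<subseteq> {m..}"
  shows "integral\<^sup>L (lebesgue_on {\<alpha>..\<alpha> + 1 / 2 ^ m}) (\<lambda>\<theta>. (cmod (lacunary_sum a J \<theta>))\<^sup>2)
    = (\<Sum>j\<in>J. (cmod (a j))\<^sup>2) / 2 ^ m"
proof -
  let ?M = "lebesgue_on {\<alpha>..\<alpha> + 1 / 2 ^ m}"
  have int: "integral\<^sup>L ?M (\<lambda>\<theta>. cis (2 * pi * (2 ^ j - 2 ^ k) * \<theta>)) = (if k = j then 1 / 2 ^ m else 0)"
    if "j \<in> J" "k \<in> J" for j k
  proof -
    have "(2 ^ j - 2 ^ k :: real) * (1 / 2 ^ m) \<in> \<int>"
      using that J by (auto simp: diff_divide_distrib intro!: Ints_diff dyadic_frequency_Ints)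
    from integral_cis_full_periods[OF this, of \<alpha>] show ?thesis by auto
  qed
  have expand: "of_real ((cmod (lacunary_sum a J \<theta>))\<^sup>2)
      = (\<Sum>j\<in>J. \<Sum>k\<in>J. a j * cnj (a k) * cis (2 * pi * (2 ^ j - 2 ^ k) * \<theta>))" for \<theta>
  proof -
    have "of_real ((cmod (lacunary_sum a J \<theta>))\<^sup>2)
      = (\<Sum>j\<in>J. \<Sum>k\<in>J. a j * cis (2 * pi * 2 ^ j * \<theta>) * cnj (a k * cis (2 * pi * 2 ^ k * \<theta>)))"
      by (simp only: complex_norm_square lacunary_sum_def sum_product cnj_sum)
    also have "\<dots> = (\<Sum>j\<in>J. \<Sum>k\<in>J. a j * cnj (a k) * cis (2 * pi * (2 ^ j - 2 ^ k) * \<theta>))"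
    proof (intro sum.cong refl)
      fix j k
      have "cis (2 * pi * (2 ^ j - 2 ^ k) * \<theta>)
          = cis (2 * pi * 2 ^ j * \<theta>) * cis (- (2 * pi * 2 ^ k * \<theta>))"
        by (simp add: cis_mult algebra_simps)
      then show "a j * cis (2 * pi * 2 ^ j * \<theta>) * cnj (a k * cis (2 * pi * 2 ^ k * \<theta>))
          = a j * cnj (a k) * cis (2 * pi * (2 ^ j - 2 ^ k) * \<theta>)"
        by (simp add: cis_cnj)
    qed
    finally show ?thesis .
  qed
  have "of_real (integral\<^sup>L ?M (\<lambda>\<theta>. (cmod (lacunary_sum a J \<theta>))\<^sup>2))
     = (LINT \<theta>|?M. complex_of_real ((cmod (lacunary_sum a J \<theta>))\<^sup>2))"
    by (rule integral_complex_of_real[symmetric])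
  also have "\<dots> = (\<Sum>j\<in>J. \<Sum>k\<in>J. a j * cnj (a k) * integral\<^sup>L ?M (\<lambda>\<theta>. cis (2 * pi * (2 ^ j - 2 ^ k) * \<theta>)))"
    unfolding expand by (simp add: Bochner_Integration.integral_sum)
  also have "\<dots> = (\<Sum>j\<in>J. \<Sum>k\<in>J. if k = j then a j * cnj (a k) / 2 ^ m else 0)"
    by (intro sum.cong refl) (simp add: int)
  also have "\<dots> = of_real ((\<Sum>j\<in>J. (cmod (a j))\<^sup>2) / 2 ^ m)"
    using J by (simp add: sum.delta complex_norm_square[symmetric] sum_divide_distrib)
  finally show ?thesis by (simp only: of_real_eq_iff)
qed

lemma fourier_coeff_eq_lebesgue_on:
  "fourier_coeff u n = integral\<^sup>L (lebesgue_on {0..1}) (\<lambda>\<theta>. u \<theta> * cis (- 2 * pi * of_int n * \<theta>))"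
  by (simp add: fourier_coeff_def set_lebesgue_integral_def integral_restrict_space)

lemma fourier_coeff_lacunary_sum:
  assumes "finite J"
  shows "fourier_coeff (lacunary_sum a J) n = (\<Sum>j\<in>J. if n = 2 ^ j then a j else 0)"
proof -
  let ?M = "lebesgue_on {0..1::real}"
  have int: "integral\<^sup>L ?M (\<lambda>\<theta>. cis (2 * pi * (2 ^ j - of_int n) * \<theta>)) = (if n = 2 ^ j then 1 else 0)" for j
  proof -
    have "(2 ^ j - of_int n = (0::real)) = (n = 2 ^ j)"
      by (metis of_int_eq_iff of_int_numeral of_int_power right_minus_eq)
    with integral_cis_full_periods[of "2 ^ j - of_int n" 1 0] show ?thesis by simp
  qed
  have "lacunary_sum a J \<theta> * cis (- 2 * pi * of_int n * \<theta>)
      = (\<Sum>j\<in>J. a j * cis (2 * pi * (2 ^ j - of_int n) * \<theta>))" for \<theta>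
    unfolding lacunary_sum_def sum_distrib_right mult.assoc cis_mult by (simp add: algebra_simps)
  then have "fourier_coeff (lacunary_sum a J) n
      = (\<Sum>j\<in>J. a j * integral\<^sup>L ?M (\<lambda>\<theta>. cis (2 * pi * (2 ^ j - of_int n) * \<theta>)))"
    by (simp add: fourier_coeff_eq_lebesgue_on Bochner_Integration.integral_sum)
  also have "\<dots> = (\<Sum>j\<in>J. if n = 2 ^ j then a j else 0)"
    by (intro sum.cong refl) (simp add: int)
  finally show ?thesis .
qed

lemma lacunary_coeff_power: "lacunary_coeff a (2 ^ j) = a j"
proof -
  have "{i. (2::int) ^ j = 2 ^ i} = {j}" by auto
  then show ?thesis by (simp add: lacunary_coeff_def)
qed

lemma lacunary_coeff_nonpos: "n \<le> 0 \<Longrightarrow> lacunary_coeff a n = 0"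
proof -
  assume "n \<le> 0"
  then have "{i. n = 2 ^ i} = {}" by (auto simp: not_le)
  then show ?thesis by (simp add: lacunary_coeff_def)
qed

section \<open>Bounded oscillation forces decay of the tails\<close>

lemma finite_measure_interval: "finite_measure (lebesgue_on {a..b::real})"
  by (simp add: finite_measure_lebesgue_on)

lemma set_integral_interval_eq:
  fixes f :: "real \<Rightarrow> 'a::{banach, second_countable_topology}"
  shows "set_lebesgue_integral lebesgue {a..b} f = integral\<^sup>L (lebesgue_on {a..b}) f"
  by (simp add: set_lebesgue_integral_def integral_restrict_space)

lemma Re_integral_dyadic_pairing_le:
  assumes u: "u \<in> borel_measurable lebesgue"
      "integrable (lebesgue_on {\<alpha>..\<alpha> + 1 / 2 ^ m}) (\<lambda>\<theta>. (cmod (u \<theta>))\<^sup>2)"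
      "integrable (lebesgue_on {\<alpha>..\<alpha> + 1 / 2 ^ m}) (\<lambda>\<theta>. u \<theta> * cnj (lacunary_sum a J \<theta>))"
    and J: "finite J" "J \<subseteq> {m..}"
  shows "2 * Re (LINT \<theta>|lebesgue_on {\<alpha>..\<alpha> + 1 / 2 ^ m}. u \<theta> * cnj (lacunary_sum a J \<theta>))
     \<le> (LINT \<theta>|lebesgue_on {\<alpha>..\<alpha> + 1 / 2 ^ m}. (cmod (u \<theta> - z))\<^sup>2)
       + (\<Sum>j\<in>J. (cmod (a j))\<^sup>2) / 2 ^ m"
proof -
  interpret finite_measure "lebesgue_on {\<alpha>..\<alpha> + 1 / 2 ^ m}" by (rule finite_measure_interval)
  have int: "integrable (lebesgue_on {\<alpha>..\<alpha> + 1 / 2 ^ m}) (lacunary_sum a J)"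
    "integrable (lebesgue_on {\<alpha>..\<alpha> + 1 / 2 ^ m}) (\<lambda>\<theta>. (cmod (lacunary_sum a J \<theta>))\<^sup>2)"
    by (intro continuous_imp_integrable_real continuous_intros)+
  show ?thesis
    using pairing_with_mean_zero_le[of u "lacunary_sum a J" z] u int
      borel_measurable_integrable[OF int(1)] integral_lacunary_sum_dyadic[OF J(2)]
    by (simp add: integral_square_lacunary_sum_dyadic[OF J] measurable_restrict_space1)
qed

text \<open>
  With \<open>P\<close> the partial sum over \<open>J\<close> and \<open>s\<close> its energy, the hypothesis on the Fourier coefficients says
  that the pairing of \<open>u\<close> with \<open>P\<close> over the circle equals \<open>s\<close>. Adding up the estimates for the pairing over the \<open>2 ^ m\<close> arcs yields
  \<open>2 * s \<le> D + s\<close>.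
\<close>

lemma tail_energy_le_dyadic_oscillation:
  assumes u: "u \<in> L2_circle" and a: "\<And>j. j \<in> J \<Longrightarrow> fourier_coeff u (2 ^ j) = a j"
    and J: "finite J" "J \<subseteq> {m..}"
    and osc: "\<And>\<alpha>. (LINT \<theta>:{\<alpha>..\<alpha> + 1 / 2 ^ m}|lebesgue. (cmod (u \<theta> - arc_avg u \<alpha> (1 / 2 ^ m)))\<^sup>2) \<le> D / 2 ^ m"
  shows "(\<Sum>j\<in>J. (cmod (a j))\<^sup>2) \<le> D"
proof -
  let ?h = "1 / 2 ^ m :: real"
  let ?s = "\<Sum>j\<in>J. (cmod (a j))\<^sup>2"
  let ?P = "lacunary_sum a J"
  let ?I = "\<lambda>k::nat. lebesgue_on {real k * ?h..real k * ?h + ?h}"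
  have [measurable]: "u \<in> borel_measurable lebesgue"
    and sq: "integrable (lebesgue_on {0..1}) (\<lambda>\<theta>. (cmod (u \<theta>))\<^sup>2)"
    using u by (auto simp: L2_circle_def set_integrable_def integrable_restrict_space)
  interpret finite_measure "lebesgue_on {0..1::real}" by (rule finite_measure_interval)
  have u_meas: "u \<in> borel_measurable (lebesgue_on S)" for S
    by (intro measurable_restrict_space1) measurable
  have u_int: "integrable (lebesgue_on {0..1}) u"
    by (rule integrable_if_square_integrable[OF u_meas sq])
  have u_cis: "integrable (lebesgue_on {0..1}) (\<lambda>\<theta>. u \<theta> * cis (x * \<theta>))" for x
  proof (rule Bochner_Integration.integrable_bound[OF u_int])
    have "(\<lambda>\<theta>. cis (x * \<theta>)) \<in> borel_measurable (lebesgue_on {0..1})"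
      by (rule borel_measurable_integrable) simp
    then show "(\<lambda>\<theta>. u \<theta> * cis (x * \<theta>)) \<in> borel_measurable (lebesgue_on {0..1})"
      using u_meas by measurable
  qed (simp add: norm_mult)
  have cnj_P: "u \<theta> * cnj (?P \<theta>) = (\<Sum>j\<in>J. cnj (a j) * (u \<theta> * cis (- 2 * pi * of_int (2 ^ j) * \<theta>)))" for \<theta>
    by (simp add: lacunary_sum_def cnj_sum cis_cnj sum_distrib_left mult_ac)
  have uP: "integrable (lebesgue_on {0..1}) (\<lambda>\<theta>. u \<theta> * cnj (?P \<theta>))"
    unfolding cnj_P by (intro Bochner_Integration.integrable_sum integrable_mult_right u_cis)
  have "(LINT \<theta>|lebesgue_on {0..1}. u \<theta> * cnj (?P \<theta>))
      = (\<Sum>j\<in>J. cnj (a j) * fourier_coeff u (2 ^ j))"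
    unfolding cnj_P fourier_coeff_eq_lebesgue_on
    by (subst Bochner_Integration.integral_sum)
       (intro integrable_mult_right u_cis, simp only: integral_mult_right_zero)
  also have "\<dots> = of_real ?s"
    by (simp add: a complex_norm_square mult.commute del: of_real_power)
  finally have total: "(LINT \<theta>|lebesgue_on {0..1}. u \<theta> * cnj (?P \<theta>)) = of_real ?s" .
  have unit: "{0..real (2 ^ m) * ?h} = {0..1}" by simp
  have split: "(LINT \<theta>|lebesgue_on {0..1}. u \<theta> * cnj (?P \<theta>))
      = (\<Sum>k<2 ^ m. LINT \<theta>|?I k. u \<theta> * cnj (?P \<theta>))"
    using integral_split_equal_intervals[of ?h "2 ^ m" "\<lambda>\<theta>. u \<theta> * cnj (?P \<theta>)"] uP unit by simp
  have local: "2 * Re (LINT \<theta>|?I k. u \<theta> * cnj (?P \<theta>)) \<le> D / 2 ^ m + ?s / 2 ^ m"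
    if k: "k < 2 ^ m" for k
  proof -
    have "real k + 1 \<le> 2 ^ m" using k by (metis Suc_eq_plus1 Suc_leI of_nat_1 of_nat_add of_nat_le_iff of_nat_numeral of_nat_power)
    then have sub: "{real k * ?h..real k * ?h + ?h} \<subseteq> {0..1}"
      by (auto simp: field_simps intro: order_trans)
    have "2 * Re (LINT \<theta>|?I k. u \<theta> * cnj (?P \<theta>))
      \<le> (LINT \<theta>|?I k. (cmod (u \<theta> - arc_avg u (real k * ?h) ?h))\<^sup>2) + ?s / 2 ^ m"
      by (intro Re_integral_dyadic_pairing_le J integrable_subinterval[OF _ sub] sq uP) measurable
    with osc[of "real k * ?h"] show ?thesis by (simp add: set_integral_interval_eq)
  qed
  have "2 * ?s = (\<Sum>k<(2::nat) ^ m. 2 * Re (LINT \<theta>|?I k. u \<theta> * cnj (?P \<theta>)))"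
    using arg_cong[OF trans[OF total[symmetric] split], of Re]
    by (simp add: sum_distrib_left[symmetric])
  also have "\<dots> \<le> (\<Sum>k<(2::nat) ^ m. D / 2 ^ m + ?s / 2 ^ m)"
    by (intro sum_mono local) simp
  also have "\<dots> = D + ?s" by (simp add: add_divide_distrib[symmetric])
  finally show ?thesis by simp
qed

lemma tail_decay_if_BMO:
  assumes r: "0 \<le> r" and c: "exp 1 \<le> c" and u: "u \<in> BMO (rho (Psi c r))"
    and a: "\<And>j. fourier_coeff u (2 ^ j) = a j"
  shows "tail_decay r a"
proof -
  let ?g = "\<lambda>t. Psi_inv (Psi c r) t / t"
  obtain A B where A: "0 < A" and lower: "\<forall>m::nat. A * (1 + real m) powr r \<le> ?g (2 ^ m)"
    using Psi_inv_ratio_dyadic[OF r c] by (elim exE conjE)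
  obtain D where D: "1 / ((rho (Psi c r) l)\<^sup>2 * l) *
      (LINT \<theta>:{\<alpha>..\<alpha> + l}|lebesgue. (cmod (u \<theta> - arc_avg u \<alpha> l))\<^sup>2) \<le> D"
    if "0 < l" "l \<le> 1" for \<alpha> l
    using u unfolding BMO_def bdd_above_def by blast
  have "((1 + real m) powr r)\<^sup>2 * (\<Sum>j=m..<n. (cmod (a j))\<^sup>2) \<le> max D 0 / A\<^sup>2" for m n
  proof -
    let ?w = "(1 + real m) powr r"
    have w: "0 < A * ?w" using A by simp
    have gw: "A * ?w \<le> ?g (2 ^ m)" using lower by blast
    have g: "0 < ?g (2 ^ m)" using w gw by linarith
    have rho: "rho (Psi c r) (1 / 2 ^ m) = 1 / ?g (2 ^ m)"
      by (simp add: rho_def)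
    have "(\<Sum>j=m..<n. (cmod (a j))\<^sup>2) \<le> D / (?g (2 ^ m))\<^sup>2"
    proof (rule tail_energy_le_dyadic_oscillation)
      show "u \<in> L2_circle" using u by (simp add: BMO_def)
      show "(LINT \<theta>:{\<alpha>..\<alpha> + 1 / 2 ^ m}|lebesgue. (cmod (u \<theta> - arc_avg u \<alpha> (1 / 2 ^ m)))\<^sup>2)
          \<le> D / (?g (2 ^ m))\<^sup>2 / 2 ^ m" for \<alpha>
        using D[of "1 / 2 ^ m" \<alpha>] g unfolding rho by (simp add: field_simps power_divide)
    qed (use a in auto)
    also have "\<dots> \<le> max D 0 / (?g (2 ^ m))\<^sup>2" by (intro divide_right_mono) auto
    also have "\<dots> \<le> max D 0 / (A * ?w)\<^sup>2"
      using w gw g by (intro divide_left_mono power_mono mult_pos_pos[of "_ ^ _"] zero_less_power) auto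
    finally show ?thesis using A by (simp add: field_simps power_mult_distrib)
  qed
  moreover have "0 \<le> max D 0 / A\<^sup>2" by simp
  ultimately show ?thesis unfolding tail_decay_def by blast
qed

section \<open>Riesz-Fischer for lacunary series\<close>

text \<open>
  Fatou's lemma for the squared moduli.
\<close>

lemma (in finite_measure) integral_square_le_of_AE_limit:
  fixes f :: "nat \<Rightarrow> 'a \<Rightarrow> complex"
  assumes [measurable]: "\<And>k. f k \<in> borel_measurable M" "g \<in> borel_measurable M"
    and lim: "AE x in M. (\<lambda>k. f k x) \<longlonglongrightarrow> g x"
    and int: "\<And>k. integrable M (\<lambda>x. (cmod (f k x))\<^sup>2)"
    and bound: "eventually (\<lambda>k. (LINT x|M. (cmod (f k x))\<^sup>2) \<le> B) sequentially"
  shows "integrable M (\<lambda>x. (cmod (g x))\<^sup>2)" "(LINT x|M. (cmod (g x))\<^sup>2) \<le> B"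
proof -
  obtain k where "(LINT x|M. (cmod (f k x))\<^sup>2) \<le> B"
    using bound by (auto simp: eventually_sequentially)
  moreover have "0 \<le> (LINT x|M. (cmod (f k x))\<^sup>2)" by simp
  ultimately have B: "0 \<le> B" by linarith
  have "(\<integral>\<^sup>+x. ennreal ((cmod (g x))\<^sup>2) \<partial>M) = (\<integral>\<^sup>+x. liminf (\<lambda>k. ennreal ((cmod (f k x))\<^sup>2)) \<partial>M)"
  proof (rule nn_integral_cong_AE, use lim in eventually_elim)
    fix x assume "(\<lambda>k. f k x) \<longlonglongrightarrow> g x"
    then have "(\<lambda>k. ennreal ((cmod (f k x))\<^sup>2)) \<longlonglongrightarrow> ennreal ((cmod (g x))\<^sup>2)"
      by (intro tendsto_intros)
    then show "ennreal ((cmod (g x))\<^sup>2) = liminf (\<lambda>k. ennreal ((cmod (f k x))\<^sup>2))"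
      by (intro lim_imp_Liminf[symmetric] sequentially_bot)
  qed
  also have "\<dots> \<le> liminf (\<lambda>k. \<integral>\<^sup>+x. ennreal ((cmod (f k x))\<^sup>2) \<partial>M)"
    by (rule nn_integral_liminf) measurable
  also have "\<dots> = liminf (\<lambda>k. ennreal (LINT x|M. (cmod (f k x))\<^sup>2))"
    using int by (simp add: nn_integral_eq_integral)
  also have "\<dots> \<le> liminf (\<lambda>k. ennreal B)"
    using bound by (intro Liminf_mono) (auto elim!: eventually_mono intro: ennreal_leI)
  also have "\<dots> = ennreal B" by (simp add: Liminf_const)
  finally have le: "(\<integral>\<^sup>+x. ennreal ((cmod (g x))\<^sup>2) \<partial>M) \<le> ennreal B" .
  show "integrable M (\<lambda>x. (cmod (g x))\<^sup>2)"
    using le by (intro integrableI_bounded) (auto simp: top_unique less_top[symmetric])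
  then show "(LINT x|M. (cmod (g x))\<^sup>2) \<le> B"
    using le B by (simp add: nn_integral_eq_integral)
qed

text \<open>
  On a finite measure space the \<open>L\<^sup>1\<close> norms inherit geometric decay from the \<open>L\<^sup>2\<close> norms, and a series
  with summable \<open>L\<^sup>1\<close> norms converges absolutely almost everywhere.
\<close>

lemma (in finite_measure) AE_summable_if_geometric_square_norms:
  fixes f :: "nat \<Rightarrow> 'a \<Rightarrow> complex"
  assumes [measurable]: "\<And>k. f k \<in> borel_measurable M"
    and int: "\<And>k. integrable M (\<lambda>x. (cmod (f k x))\<^sup>2)"
    and bound: "\<And>k. (LINT x|M. (cmod (f k x))\<^sup>2) \<le> C / 4 ^ k"
  shows "summable (\<lambda>k. LINT x|M. cmod (f k x))" "AE x in M. summable (\<lambda>k. cmod (f k x))"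
proof -
  have f: "integrable M (\<lambda>x. cmod (f k x))" for k
    using integrable_if_square_integrable[OF assms(1) int] by (rule integrable_norm)
  have L1: "(LINT x|M. cmod (f k x)) \<le> (measure M (space M) + C) * (1 / 2) ^ k" for k
  proof -
    \<comment> \<open>The factor \<open>2 ^ k\<close> balances both terms: the second one integrates to at most \<open>C / 2 ^ k\<close>.\<close>
    have "cmod (f k x) \<le> (1 / 2) ^ k + 2 ^ k * (cmod (f k x))\<^sup>2" for x
    proof -
      let ?t = "cmod (f k x)"
      have "0 \<le> (1 - 2 ^ k * ?t)\<^sup>2" by simp
      then have "2 * (2 ^ k * ?t) \<le> 1 + (2 ^ k * ?t)\<^sup>2"
        by (simp add: power2_eq_square algebra_simps)
      moreover have "0 \<le> 2 ^ k * ?t" by simp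
      ultimately have "2 ^ k * ?t \<le> 1 + (2 ^ k * ?t)\<^sup>2" by linarith
      then show ?thesis by (simp add: field_simps power2_eq_square power_one_over)
    qed
    then have "(LINT x|M. cmod (f k x)) \<le> (LINT x|M. (1 / 2) ^ k + 2 ^ k * (cmod (f k x))\<^sup>2)"
      using f int by (intro integral_mono) auto
    also have "\<dots> = measure M (space M) * (1 / 2) ^ k + 2 ^ k * (LINT x|M. (cmod (f k x))\<^sup>2)"
      using int by simp
    also have "\<dots> \<le> measure M (space M) * (1 / 2) ^ k + 2 ^ k * (C / 4 ^ k)"
      by (intro add_left_mono mult_left_mono bound) simp
    also have "2 ^ k * (C / 4 ^ k) = C * (1 / 2) ^ k"
      by (simp add: power_one_over field_simps power_mult_distrib[symmetric])
    finally show ?thesis by (simp add: algebra_simps)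
  qed
  show sum: "summable (\<lambda>k. LINT x|M. cmod (f k x))"
  proof (rule summable_comparison_test')
    show "summable (\<lambda>k. (measure M (space M) + C) * (1 / 2) ^ k)"
      by (intro summable_mult summable_geometric) simp
    show "norm (LINT x|M. cmod (f k x)) \<le> (measure M (space M) + C) * (1 / 2) ^ k" if "k \<ge> 0" for k
      using L1[of k] by simp
  qed
  have "(\<integral>\<^sup>+x. (\<Sum>k. ennreal (cmod (f k x))) \<partial>M) = (\<Sum>k. \<integral>\<^sup>+x. ennreal (cmod (f k x)) \<partial>M)"
    by (rule nn_integral_suminf) measurable
  also have "\<dots> = (\<Sum>k. ennreal (LINT x|M. cmod (f k x)))"
    using f by (simp add: nn_integral_eq_integral)
  also have "\<dots> \<noteq> \<infinity>" unfolding infinity_ennreal_def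
    by (rule ennreal_suminf_neq_top[OF sum]) simp
  finally have "AE x in M. (\<Sum>k. ennreal (cmod (f k x))) \<noteq> \<infinity>"
    by (intro nn_integral_PInf_AE) measurable
  then show "AE x in M. summable (\<lambda>k. cmod (f k x))"
    by eventually_elim (simp add: summable_suminf_not_top)
qed

text \<open>
  The starting value \<open>\<phi> 0 = 0\<close> makes the blocks between consecutive values of \<open>\<phi>\<close> exhaust the series.
  The constant \<open>C\<close> absorbs the bound for the whole series that this forces at \<open>k = 0\<close>.
\<close>

lemma geometric_tail_subsequence:
  fixes b :: "nat \<Rightarrow> real"
  assumes b: "summable b" "\<And>j. 0 \<le> b j"
  shows "\<exists>(\<phi> :: nat \<Rightarrow> nat) C. strict_mono \<phi> \<and> \<phi> 0 = 0 \<and> (\<forall>k n. sum b {\<phi> k..<n} \<le> C / 4 ^ k)"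
proof -
  define C where "C = suminf b + 1"
  have C: "0 < C" using suminf_nonneg[OF b] by (simp add: C_def)
  let ?P = "\<lambda>k m. (k = 0 \<longrightarrow> m = 0) \<and> (\<forall>n. sum b {m..<n} \<le> C / 4 ^ k)"
  have "\<exists>\<phi>. \<forall>k. ?P k (\<phi> k) \<and> \<phi> k < \<phi> (Suc k)"
  proof (rule dependent_nat_choice)
    have "sum b {0..<n} \<le> C" for n
    proof -
      have "sum b {0..<n} \<le> suminf b" using b by (intro sum_le_suminf) auto
      then show ?thesis by (simp add: C_def)
    qed
    then show "\<exists>m. ?P 0 m" by auto
  next
    fix m k :: nat
    have "0 < C / 4 ^ Suc k" using C by simp
    then obtain N where N: "\<And>m n. m \<ge> N \<Longrightarrow> norm (sum b {m..<n}) < C / 4 ^ Suc k"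
      using b(1) unfolding summable_Cauchy by blast
    have "sum b {max N (Suc m)..<n} \<le> C / 4 ^ Suc k" for n
      using N[of "max N (Suc m)" n] by simp
    then show "\<exists>m'. ?P (Suc k) m' \<and> m < m'"
      by (intro exI[of _ "max N (Suc m)"]) auto
  qed
  then obtain \<phi> where \<phi>: "\<forall>k. ?P k (\<phi> k) \<and> \<phi> k < \<phi> (Suc k)" by (elim exE)
  then have "strict_mono \<phi>" by (simp add: strict_mono_Suc_iff)
  with \<phi> show ?thesis by blast
qed

lemma lacunary_sum_blocks:
  assumes "strict_mono \<phi>" "\<phi> 0 = 0"
  shows "(\<Sum>k<K. lacunary_sum a {\<phi> k..<\<phi> (Suc k)} \<theta>) = lacunary_sum a {..<\<phi> K} \<theta>"
proof (induction K)
  case (Suc K)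
  have "\<phi> K \<le> \<phi> (Suc K)" using assms(1) by (simp add: strict_mono_less_eq)
  then show ?case using Suc
    by (simp add: lacunary_sum_def lessThan_atLeast0 sum.atLeastLessThan_concat)
qed (simp add: assms lacunary_sum_def)

text \<open>
  The function is the sum of the blocks \<open>T k\<close> between the indices \<open>\<phi> k\<close> and \<open>\<phi> (Suc k)\<close>, whose
  square norms decay geometrically over every unit interval. Their series converges absolutely
  almost everywhere, and may be integrated term by term, which gives the Fourier coefficients. Being
  defined pointwise from periodic sums, \<open>u\<close> is periodic everywhere, including the points where
  the series diverges.
\<close>

lemma lacunary_riesz_fischer:
  assumes a: "summable (\<lambda>j. (cmod (a j))\<^sup>2)"
  shows "\<exists>u (\<phi> :: nat \<Rightarrow> nat). u \<in> borel_measurable lebesgue \<and> (\<forall>\<theta>. u (\<theta> + 1) = u \<theta>) \<and>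
    strict_mono \<phi> \<and> (AE \<theta> in lebesgue. (\<lambda>k. lacunary_sum a {..<\<phi> k} \<theta>) \<longlonglongrightarrow> u \<theta>) \<and>
    is_fourier_series_of (lacunary_coeff a) u"
proof -
  obtain \<phi> C where \<phi>: "strict_mono \<phi>" "\<phi> 0 = 0"
    and tail: "\<forall>k n. (\<Sum>j=\<phi> k..<n. (cmod (a j))\<^sup>2) \<le> C / 4 ^ k"
    using geometric_tail_subsequence[OF a zero_le_power2] by (elim exE conjE)
  from tail have C: "(\<Sum>j=\<phi> k..<n. (cmod (a j))\<^sup>2) \<le> C / 4 ^ k" for k n by blast
  define T where "T k = lacunary_sum a {\<phi> k..<\<phi> (Suc k)}" for k
  define u where "u \<theta> = (\<Sum>k. T k \<theta>)" for \<theta>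
  have T_cont: "continuous_on S (T k)" for S k
    unfolding T_def by (intro continuous_intros)
  have T_meas [measurable]: "T k \<in> borel_measurable lebesgue" for k
    using borel_measurable_continuous_onI[OF T_cont] by (simp add: measurable_completion)
  have T_meas' : "T k \<in> borel_measurable (lebesgue_on S)" for k S
    by (intro measurable_restrict_space1) measurable
  have partial: "(\<Sum>k<K. T k \<theta>) = lacunary_sum a {..<\<phi> K} \<theta>" for K \<theta>
    unfolding T_def by (rule lacunary_sum_blocks[OF \<phi>])
  have unit: "summable (\<lambda>k. LINT \<theta>|lebesgue_on {\<alpha>..\<alpha> + 1}. cmod (T k \<theta>))"
    "AE \<theta> in lebesgue_on {\<alpha>..\<alpha> + 1}. summable (\<lambda>k. cmod (T k \<theta>))" for \<alpha> :: real
  proof -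
    interpret finite_measure "lebesgue_on {\<alpha>..\<alpha> + 1}" by (rule finite_measure_interval)
    have int: "integrable (lebesgue_on {\<alpha>..\<alpha> + 1}) (\<lambda>\<theta>. (cmod (T k \<theta>))\<^sup>2)" for k
      by (intro continuous_imp_integrable_real continuous_intros T_cont)
    have "(LINT \<theta>|lebesgue_on {\<alpha>..\<alpha> + 1}. (cmod (T k \<theta>))\<^sup>2) \<le> C / 4 ^ k" for k
      using integral_square_lacunary_sum_dyadic[of "{\<phi> k..<\<phi> (Suc k)}" 0 \<alpha> a] C[of k "\<phi> (Suc k)"]
      by (simp add: T_def)
    from AE_summable_if_geometric_square_norms[OF T_meas' int this]
    show "summable (\<lambda>k. LINT \<theta>|lebesgue_on {\<alpha>..\<alpha> + 1}. cmod (T k \<theta>))"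
      "AE \<theta> in lebesgue_on {\<alpha>..\<alpha> + 1}. summable (\<lambda>k. cmod (T k \<theta>))" by blast+
  qed
  \<comment> \<open>Countably many unit intervals cover the line.\<close>
  have "AE \<theta> in lebesgue. \<forall>z::int. \<theta> \<in> {of_int z..of_int z + 1} \<longrightarrow> summable (\<lambda>k. cmod (T k \<theta>))"
    unfolding AE_all_countable using unit(2) by (simp add: AE_restrict_space_iff)
  then have summable: "AE \<theta> in lebesgue. summable (\<lambda>k. cmod (T k \<theta>))"
  proof eventually_elim
    fix \<theta> assume "\<forall>z::int. \<theta> \<in> {of_int z..of_int z + 1} \<longrightarrow> summable (\<lambda>k. cmod (T k \<theta>))"
    from spec[OF this, of "\<lfloor>\<theta>\<rfloor>"] show "summable (\<lambda>k. cmod (T k \<theta>))"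
      using floor_correct[of \<theta>] by (simp add: order_less_imp_le)
  qed
  have u_meas: "u \<in> borel_measurable lebesgue" unfolding u_def by measurable
  have coeff: "fourier_coeff u n = lacunary_coeff a n" for n
  proof -
    let ?M = "lebesgue_on {0..1::real}"
    let ?e = "\<lambda>\<theta>. cis (- 2 * pi * of_int n * \<theta>)"
    have ae: "AE \<theta> in ?M. summable (\<lambda>k. cmod (T k \<theta>))" using unit(2)[of 0] by (simp only: add_0)
    have "(\<lambda>k. LINT \<theta>|?M. T k \<theta> * ?e \<theta>) sums (LINT \<theta>|?M. (\<Sum>k. T k \<theta> * ?e \<theta>))"
    proof (rule sums_integral)
      show "integrable ?M (\<lambda>\<theta>. T k \<theta> * ?e \<theta>)" for k
        by (intro continuous_imp_integrable_real continuous_intros T_cont)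
    qed (use ae unit(1)[of 0] in \<open>simp_all add: norm_mult\<close>)
    also have "(LINT \<theta>|?M. (\<Sum>k. T k \<theta> * ?e \<theta>)) = fourier_coeff u n"
      unfolding fourier_coeff_eq_lebesgue_on
    proof (rule integral_cong_AE)
      have "?e \<in> borel_measurable borel"
        by (intro borel_measurable_continuous_onI continuous_intros)
      then have "?e \<in> borel_measurable lebesgue" by (simp add: measurable_completion)
      then show "(\<lambda>\<theta>. \<Sum>k. T k \<theta> * ?e \<theta>) \<in> borel_measurable ?M"
        "(\<lambda>\<theta>. u \<theta> * ?e \<theta>) \<in> borel_measurable ?M"
        using u_meas by (intro measurable_restrict_space1; measurable)+
      show "AE \<theta> in ?M. (\<Sum>k. T k \<theta> * ?e \<theta>) = u \<theta> * ?e \<theta>"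
        using ae
      proof eventually_elim
        fix \<theta> assume "summable (\<lambda>k. cmod (T k \<theta>))"
        from suminf_mult2[OF summable_norm_cancel[OF this], of "?e \<theta>"]
        show "(\<Sum>k. T k \<theta> * ?e \<theta>) = u \<theta> * ?e \<theta>" unfolding u_def by (rule sym)
      qed
    qed
    finally have "(\<lambda>k. fourier_coeff (T k) n) sums fourier_coeff u n"
      by (simp add: fourier_coeff_eq_lebesgue_on)
    moreover have "(\<lambda>k. fourier_coeff (T k) n) sums lacunary_coeff a n"
    proof -
      have part: "(\<Sum>k<K. fourier_coeff (T k) n) = (\<Sum>j<\<phi> K. if n = 2 ^ j then a j else 0)" for K
      proof (induction K)
        case (Suc K)
        have "\<phi> K \<le> \<phi> (Suc K)" using \<phi>(1) by (simp add: strict_mono_less_eq)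
        then show ?case using Suc
          by (simp add: T_def fourier_coeff_lacunary_sum lessThan_atLeast0 sum.atLeastLessThan_concat)
      qed (simp add: \<phi>)
      have "eventually (\<lambda>K. (\<Sum>j<\<phi> K. if n = 2 ^ j then a j else 0) = lacunary_coeff a n) sequentially"
      proof (cases "\<exists>i. n = 2 ^ i")
        case True
        then obtain i where i: "n = 2 ^ i" by blast
        have "(\<Sum>j<\<phi> K. if n = 2 ^ j then a j else 0) = lacunary_coeff a n" if "K \<ge> Suc i" for K
        proof -
          have "i < \<phi> K" using that strict_mono_imp_increasing[OF \<phi>(1), of K] by linarith
          then show ?thesis by (simp add: i lacunary_coeff_power sum.delta')
        qed
        then show ?thesis by (auto simp: eventually_sequentially)
      next
        case False
        then show ?thesis by (simp add: lacunary_coeff_def)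
      qed
      then show ?thesis unfolding sums_def part by (rule tendsto_eventually)
    qed
    ultimately show ?thesis by (rule sums_unique2)
  qed
  show ?thesis
  proof (intro exI conjI allI)
    show "u \<in> borel_measurable lebesgue" by (rule u_meas)
    show "u (\<theta> + 1) = u \<theta>" for \<theta> by (simp add: u_def T_def lacunary_sum_periodic)
    show "strict_mono \<phi>" by (rule \<phi>(1))
    show "AE \<theta> in lebesgue. (\<lambda>k. lacunary_sum a {..<\<phi> k} \<theta>) \<longlonglongrightarrow> u \<theta>"
      using summable
    proof eventually_elim
      fix \<theta> assume "summable (\<lambda>k. cmod (T k \<theta>))"
      then have "(\<lambda>k. T k \<theta>) sums u \<theta>" unfolding u_def
        by (rule summable_sums[OF summable_norm_cancel])
      then show "(\<lambda>k. lacunary_sum a {..<\<phi> k} \<theta>) \<longlonglongrightarrow> u \<theta>"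
        by (simp add: sums_def partial)
    qed
    show "is_fourier_series_of (lacunary_coeff a) u" by (simp add: is_fourier_series_of_def coeff)
  qed
qed

section \<open>Decay of the tails forces bounded oscillation\<close>

text \<open>
  The last terms dominate: since \<open>1 + m \<le> (1 + j) * (1 + (m - j))\<close>, the term of index \<open>j\<close> is at most
  \<open>(1 + i) powr r / 2 ^ i\<close> times the claimed bound, where \<open>i = m - j\<close>, and these factors are summable.
\<close>

lemma sum_dyadic_powr_le:
  assumes r: "0 \<le> r"
  shows "\<exists>D\<ge>0. \<forall>m. (\<Sum>j<m. 2 ^ j / (1 + real j) powr r) \<le> D * 2 ^ m / (1 + real m) powr r"
proof -
  define \<phi> where "\<phi> i = (1 + real i) powr r * (1 / 2) ^ i" for i
  have \<phi>_nonneg: "0 \<le> \<phi> i" for i by (simp add: \<phi>_def)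
  have "\<phi> \<in> O(\<lambda>i. (3 / 4) ^ i)" unfolding \<phi>_def by real_asymp
  then have summable: "summable \<phi>"
    by (rule summable_comparison_test_bigo[rotated]) simp
  have "(\<Sum>j<m. 2 ^ j / (1 + real j) powr r) \<le> suminf \<phi> * 2 ^ m / (1 + real m) powr r" for m
  proof -
    have "2 ^ j / (1 + real j) powr r \<le> \<phi> (m - j) * 2 ^ m / (1 + real m) powr r" if j: "j < m" for j
    proof -
      have m: "real m = real j + real (m - j)" using j by simp
      have "1 + real m \<le> (1 + real j) * (1 + real (m - j))"
        unfolding m by (simp add: algebra_simps)
      then have "(1 + real m) powr r \<le> ((1 + real j) * (1 + real (m - j))) powr r"
        using r by (intro powr_mono2) auto
      also have "\<dots> = (1 + real j) powr r * (1 + real (m - j)) powr r"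
        by (simp add: powr_mult)
      finally have "2 ^ j / (1 + real j) powr r \<le> (1 + real (m - j)) powr r * 2 ^ j / (1 + real m) powr r"
        by (simp add: field_simps)
      also have "(1 + real (m - j)) powr r * 2 ^ j = \<phi> (m - j) * 2 ^ m"
        using j by (simp add: \<phi>_def power_diff power_one_over)
      finally show ?thesis .
    qed
    then have "(\<Sum>j<m. 2 ^ j / (1 + real j) powr r) \<le> (\<Sum>j<m. \<phi> (m - j) * 2 ^ m / (1 + real m) powr r)"
      by (intro sum_mono) auto
    also have "\<dots> = (\<Sum>j<m. \<phi> (m - j)) * 2 ^ m / (1 + real m) powr r"
      by (simp add: sum_distrib_right sum_divide_distrib)
    also have "(\<Sum>j<m. \<phi> (m - j)) = sum \<phi> ((\<lambda>j. m - j) ` {..<m})"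
      by (subst sum.reindex) (auto simp: inj_on_def)
    also have "sum \<phi> ((\<lambda>j. m - j) ` {..<m}) * 2 ^ m / (1 + real m) powr r
        \<le> suminf \<phi> * 2 ^ m / (1 + real m) powr r"
      using \<phi>_nonneg by (intro divide_right_mono mult_right_mono sum_le_suminf summable) auto
    finally show ?thesis .
  qed
  moreover have "0 \<le> suminf \<phi>" by (rule suminf_nonneg[OF summable \<phi>_nonneg])
  ultimately show ?thesis by blast
qed

lemma norm_cis_diff_le: "cmod (cis x - cis y) \<le> \<bar>x - y\<bar>"
proof -
  have "cis x - cis y = cis y * (cis (x - y) - 1)" by (simp add: right_diff_distrib cis_mult)
  then have "cmod (cis x - cis y) = cmod (exp (\<i> * of_real (x - y)) - 1)"
    by (simp add: norm_mult cis_conv_exp)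
  also have "\<dots> = 2 * \<bar>sin ((x - y) / 2)\<bar>" by (rule dist_exp_i_1)
  also have "\<dots> \<le> 2 * \<bar>(x - y) / 2\<bar>" by (intro mult_left_mono abs_sin_x_le_abs_x) simp
  finally show ?thesis by simp
qed

lemma lacunary_sum_diff_le:
  "cmod (lacunary_sum a {..<m} \<theta> - lacunary_sum a {..<m} \<alpha>)
     \<le> 2 * pi * \<bar>\<theta> - \<alpha>\<bar> * (\<Sum>j<m. cmod (a j) * 2 ^ j)"
proof -
  have "cmod (lacunary_sum a {..<m} \<theta> - lacunary_sum a {..<m} \<alpha>)
      \<le> (\<Sum>j<m. cmod (a j * (cis (2 * pi * 2 ^ j * \<theta>) - cis (2 * pi * 2 ^ j * \<alpha>))))"
    unfolding lacunary_sum_def sum_subtractf[symmetric] right_diff_distrib by (rule norm_sum)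
  also have "\<dots> \<le> (\<Sum>j<m. cmod (a j) * (2 * pi * 2 ^ j * \<bar>\<theta> - \<alpha>\<bar>))"
  proof (rule sum_mono)
    fix j
    have "cmod (cis (2 * pi * 2 ^ j * \<theta>) - cis (2 * pi * 2 ^ j * \<alpha>)) \<le> 2 * pi * 2 ^ j * \<bar>\<theta> - \<alpha>\<bar>"
      using norm_cis_diff_le[of "2 * pi * 2 ^ j * \<theta>" "2 * pi * 2 ^ j * \<alpha>"]
      by (simp add: right_diff_distrib[symmetric] abs_mult)
    then show "cmod (a j * (cis (2 * pi * 2 ^ j * \<theta>) - cis (2 * pi * 2 ^ j * \<alpha>)))
        \<le> cmod (a j) * (2 * pi * 2 ^ j * \<bar>\<theta> - \<alpha>\<bar>)"
      unfolding norm_mult by (rule mult_left_mono) simp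
  qed
  also have "\<dots> = 2 * pi * \<bar>\<theta> - \<alpha>\<bar> * (\<Sum>j<m. cmod (a j) * 2 ^ j)"
    by (simp add: sum_distrib_left mult_ac)
  finally show ?thesis .
qed

lemma integral_mono_interval:
  assumes "continuous_on {a..d} f" "\<And>x. 0 \<le> f x" "{b..c} \<subseteq> {a..d}"
  shows "integral\<^sup>L (lebesgue_on {b..c}) f \<le> integral\<^sup>L (lebesgue_on {a..d}) (f :: real \<Rightarrow> real)"
proof -
  have "integrable (lebesgue_on {a..d}) f" by (rule continuous_imp_integrable_real[OF assms(1)])
  moreover from this have "integrable (lebesgue_on {b..c}) f" by (rule integrable_subinterval[OF _ assms(3)])
  ultimately show ?thesis using assms(2,3)
    by (auto simp: lebesgue_integral_eq_integral intro!: integral_subset_le integrable_on_lebesgue_on)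
qed

text \<open>
  The terms of index below \<open>m\<close> have frequencies below \<open>1 / l\<close>, so that their variation over the arc
  is bounded by \<open>l\<close> times the sum of \<open>2 ^ j / (1 + j) powr r\<close> up to a constant. The terms from \<open>m\<close> on have period
  \<open>1 / 2 ^ m\<close>, which is between \<open>l\<close> and \<open>2 * l\<close>, and enlarging the arc to a full period costs
  at most a constant factor. The bound is uniform in \<open>n\<close>, as Fatou's lemma requires.
\<close>

lemma partial_sum_oscillation_le:
  assumes r: "0 \<le> r" and decay: "tail_decay r a"
  shows "\<exists>E\<ge>0. \<forall>\<alpha> l m n. 0 < l \<longrightarrow> 2 ^ m \<le> 1 / l \<longrightarrow> 1 / l < 2 ^ Suc m \<longrightarrow> m \<le> n \<longrightarrow>
     (LINT \<theta>|lebesgue_on {\<alpha>..\<alpha> + l}. (cmod (lacunary_sum a {..<n} \<theta> - lacunary_sum a {..<m} \<alpha>))\<^sup>2)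
       \<le> E * l / ((1 + real m) powr r)\<^sup>2"
proof -
  obtain K where K: "0 \<le> K"
    and tail: "\<And>m n. ((1 + real m) powr r)\<^sup>2 * (\<Sum>j=m..<n. (cmod (a j))\<^sup>2) \<le> K"
    using decay unfolding tail_decay_def by blast
  obtain D where D: "0 \<le> D"
    and sumD: "\<forall>m. (\<Sum>j<m. 2 ^ j / (1 + real j) powr r) \<le> D * 2 ^ m / (1 + real m) powr r"
    using sum_dyadic_powr_le[OF r] by (elim exE conjE)
  define F where "F = 2 * pi * sqrt K * D"
  have F: "0 \<le> F" using K D by (simp add: F_def)
  have "(LINT \<theta>|lebesgue_on {\<alpha>..\<alpha> + l}. (cmod (lacunary_sum a {..<n} \<theta> - lacunary_sum a {..<m} \<alpha>))\<^sup>2)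
       \<le> (2 * F\<^sup>2 + 4 * K) * l / ((1 + real m) powr r)\<^sup>2"
    if l: "0 < l" "2 ^ m \<le> 1 / l" "1 / l < 2 ^ Suc m" and mn: "m \<le> n" for \<alpha> l m n
  proof -
    let ?I = "lebesgue_on {\<alpha>..\<alpha> + l}"
    let ?w = "(1 + real m) powr r"
    let ?S = "\<lambda>\<theta>. lacunary_sum a {..<m} \<theta> - lacunary_sum a {..<m} \<alpha>"
    let ?R = "lacunary_sum a {m..<n}"
    have w: "0 < ?w" by simp
    have l2: "l * 2 ^ m \<le> 1" "1 / 2 ^ m \<le> 2 * l" "l \<le> 1 / 2 ^ m"
      using l by (simp_all add: field_simps)
    have coeff: "cmod (a j) \<le> sqrt K / (1 + real j) powr r" for j
    proof -
      have "((1 + real j) powr r * cmod (a j))\<^sup>2 \<le> K"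
        using tail[of j "Suc j"] by (simp add: power_mult_distrib)
      then have "(1 + real j) powr r * cmod (a j) \<le> sqrt K" by (rule real_le_rsqrt)
      then show ?thesis by (simp add: field_simps)
    qed
    have low: "cmod (?S \<theta>) \<le> F / ?w" if \<theta>: "\<theta> \<in> {\<alpha>..\<alpha> + l}" for \<theta>
    proof -
      have "(\<Sum>j<m. cmod (a j) * 2 ^ j) \<le> (\<Sum>j<m. sqrt K * (2 ^ j / (1 + real j) powr r))"
      proof (rule sum_mono)
        fix j
        have "cmod (a j) * 2 ^ j \<le> sqrt K / (1 + real j) powr r * 2 ^ j"
          by (intro mult_right_mono coeff) simp
        then show "cmod (a j) * 2 ^ j \<le> sqrt K * (2 ^ j / (1 + real j) powr r)" by simp
      qed
      also have "\<dots> \<le> sqrt K * (D * 2 ^ m / ?w)"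
        unfolding sum_distrib_left[symmetric] using sumD K by (intro mult_left_mono) auto
      finally have coeffs: "(\<Sum>j<m. cmod (a j) * 2 ^ j) \<le> sqrt K * (D * 2 ^ m / ?w)" .
      have "cmod (?S \<theta>) \<le> 2 * pi * \<bar>\<theta> - \<alpha>\<bar> * (\<Sum>j<m. cmod (a j) * 2 ^ j)"
        by (rule lacunary_sum_diff_le)
      also have "\<dots> \<le> 2 * pi * l * (sqrt K * (D * 2 ^ m / ?w))"
        using \<theta> l coeffs by (intro mult_mono sum_nonneg) auto
      also have "\<dots> = (l * 2 ^ m) * (F / ?w)" by (simp add: F_def)
      also have "\<dots> \<le> 1 * (F / ?w)" using l2(1) F by (intro mult_right_mono) auto
      finally show ?thesis by simp
    qed
    have cont: "continuous_on S (\<lambda>\<theta>. (cmod (lacunary_sum a {..<n} \<theta> - lacunary_sum a {..<m} \<alpha>))\<^sup>2)"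
      "continuous_on S (\<lambda>\<theta>. (cmod (?R \<theta>))\<^sup>2)" for S
      by (intro continuous_intros)+
    have int: "integrable ?I (\<lambda>\<theta>. (cmod (lacunary_sum a {..<n} \<theta> - lacunary_sum a {..<m} \<alpha>))\<^sup>2)"
      "integrable ?I (\<lambda>\<theta>. (cmod (?R \<theta>))\<^sup>2)"
      by (intro continuous_imp_integrable_real cont)+
    interpret finite_measure ?I by (rule finite_measure_interval)
    have "(LINT \<theta>|?I. (cmod (lacunary_sum a {..<n} \<theta> - lacunary_sum a {..<m} \<alpha>))\<^sup>2)
        \<le> (LINT \<theta>|?I. 2 * (F / ?w)\<^sup>2 + 2 * (cmod (?R \<theta>))\<^sup>2)"
    proof (rule integral_mono)
      fix \<theta> assume "\<theta> \<in> space ?I"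
      then have \<theta>: "\<theta> \<in> {\<alpha>..\<alpha> + l}" by simp
      have "lacunary_sum a {..<n} \<theta> = lacunary_sum a {..<m} \<theta> + ?R \<theta>"
        using mn by (simp add: lacunary_sum_def lessThan_atLeast0 sum.atLeastLessThan_concat)
      then have split: "lacunary_sum a {..<n} \<theta> - lacunary_sum a {..<m} \<alpha> = ?S \<theta> + ?R \<theta>" by simp
      have "cmod (lacunary_sum a {..<n} \<theta> - lacunary_sum a {..<m} \<alpha>) \<le> F / ?w + cmod (?R \<theta>)"
        unfolding split using low[OF \<theta>] norm_triangle_ineq[of "?S \<theta>" "?R \<theta>"] by linarith
      then have "(cmod (lacunary_sum a {..<n} \<theta> - lacunary_sum a {..<m} \<alpha>))\<^sup>2 \<le> (F / ?w + cmod (?R \<theta>))\<^sup>2"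
        by (intro power_mono) auto
      also have "\<dots> \<le> 2 * (F / ?w)\<^sup>2 + 2 * (cmod (?R \<theta>))\<^sup>2"
        using sum_squares_bound[of "F / ?w" "cmod (?R \<theta>)"] by (simp add: power2_sum)
      finally show "(cmod (lacunary_sum a {..<n} \<theta> - lacunary_sum a {..<m} \<alpha>))\<^sup>2
          \<le> 2 * (F / ?w)\<^sup>2 + 2 * (cmod (?R \<theta>))\<^sup>2" .
    qed (use int in auto)
    also have "\<dots> = 2 * (F / ?w)\<^sup>2 * l + 2 * (LINT \<theta>|?I. (cmod (?R \<theta>))\<^sup>2)"
      using int l by (simp add: measure_restrict_space)
    also have "(LINT \<theta>|?I. (cmod (?R \<theta>))\<^sup>2)
        \<le> (LINT \<theta>|lebesgue_on {\<alpha>..\<alpha> + 1 / 2 ^ m}. (cmod (?R \<theta>))\<^sup>2)"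
      using l2(3) by (intro integral_mono_interval cont) auto
    also have "\<dots> = (\<Sum>j=m..<n. (cmod (a j))\<^sup>2) * (1 / 2 ^ m)"
      by (subst integral_square_lacunary_sum_dyadic) auto
    also have "\<dots> \<le> (K / ?w\<^sup>2) * (2 * l)"
      using tail[of m n] w l2(2) K by (intro mult_mono) (auto simp: field_simps sum_nonneg)
    finally show ?thesis by (simp add: field_simps power_divide)
  qed
  moreover have "0 \<le> 2 * F\<^sup>2 + 4 * K" using K by simp
  ultimately show ?thesis by blast
qed

lemma dyadic_scale:
  fixes l :: real
  assumes "0 < l" "l \<le> 1"
  obtains m :: nat where "2 ^ m \<le> 1 / l" "1 / l < 2 ^ Suc m"
proof -
  obtain n where "1 / l < 2 ^ n" using real_arch_pow[of 2 "1 / l"] by auto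
  moreover have "\<not> 1 / l < 2 ^ 0" using assms by simp
  ultimately obtain m where "\<forall>i\<le>m. \<not> 1 / l < 2 ^ i" "1 / l < 2 ^ Suc m"
    using ex_least_nat_less[of "\<lambda>n. 1 / l < 2 ^ n" n] by blast
  then show ?thesis using that by (meson not_less order_refl)
qed

lemma BMOA_if_tail_decay:
  assumes r: "0 \<le> r" and c: "exp 1 \<le> c" and decay: "tail_decay r a"
  shows "\<exists>u \<in> BMOA (rho (Psi c r)). is_fourier_series_of (lacunary_coeff a) u"
proof -
  let ?g = "\<lambda>t. Psi_inv (Psi c r) t / t"
  obtain K where K: "0 \<le> K"
    and tail: "\<And>m n. ((1 + real m) powr r)\<^sup>2 * (\<Sum>j=m..<n. (cmod (a j))\<^sup>2) \<le> K"
    using decay unfolding tail_decay_def by blast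
  have energy: "(\<Sum>j<n. (cmod (a j))\<^sup>2) \<le> K" for n
    using tail[of 0 n] by (simp add: lessThan_atLeast0)
  have summable: "summable (\<lambda>j. (cmod (a j))\<^sup>2)"
    by (rule summableI_nonneg_bounded[OF _ energy]) simp
  obtain u \<phi> where u_meas: "u \<in> borel_measurable lebesgue" and periodic: "\<forall>\<theta>. u (\<theta> + 1) = u \<theta>"
    and \<phi>: "strict_mono \<phi>"
    and lim: "AE \<theta> in lebesgue. (\<lambda>k. lacunary_sum a {..<\<phi> k} \<theta>) \<longlonglongrightarrow> u \<theta>"
    and fourier: "is_fourier_series_of (lacunary_coeff a) u"
    using lacunary_riesz_fischer[OF summable] by (elim exE conjE)
  \<comment> \<open>Bounds for all late partial sums pass to \<open>u\<close>, whatever the constant \<open>z\<close>.\<close>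
  have local: "integrable (lebesgue_on {\<alpha>..\<beta>}) (\<lambda>\<theta>. (cmod (u \<theta> - z))\<^sup>2)"
      "(LINT \<theta>|lebesgue_on {\<alpha>..\<beta>}. (cmod (u \<theta> - z))\<^sup>2) \<le> B"
    if bound: "\<And>n. n \<ge> N \<Longrightarrow> (LINT \<theta>|lebesgue_on {\<alpha>..\<beta>}. (cmod (lacunary_sum a {..<n} \<theta> - z))\<^sup>2) \<le> B"
    for \<alpha> \<beta> z B N
  proof -
    interpret finite_measure "lebesgue_on {\<alpha>..\<beta>}" by (rule finite_measure_interval)
    have "integrable (lebesgue_on {\<alpha>..\<beta>}) (\<lambda>\<theta>. lacunary_sum a {..<\<phi> k} \<theta> - z)" for k
      by (intro continuous_imp_integrable_real continuous_intros)
    then have 1: "(\<lambda>\<theta>. lacunary_sum a {..<\<phi> k} \<theta> - z) \<in> borel_measurable (lebesgue_on {\<alpha>..\<beta>})" for k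
      by (rule borel_measurable_integrable)
    have 2: "(\<lambda>\<theta>. u \<theta> - z) \<in> borel_measurable (lebesgue_on {\<alpha>..\<beta>})"
      by (intro measurable_restrict_space1 borel_measurable_diff u_meas) simp
    have "AE \<theta> in lebesgue. (\<lambda>k. lacunary_sum a {..<\<phi> k} \<theta> - z) \<longlonglongrightarrow> u \<theta> - z"
      using lim by eventually_elim (intro tendsto_intros)
    then have 3: "AE \<theta> in lebesgue_on {\<alpha>..\<beta>}. (\<lambda>k. lacunary_sum a {..<\<phi> k} \<theta> - z) \<longlonglongrightarrow> u \<theta> - z"
      by (simp add: AE_restrict_space_iff) (erule eventually_mono, blast)
    have 4: "integrable (lebesgue_on {\<alpha>..\<beta>}) (\<lambda>\<theta>. (cmod (lacunary_sum a {..<\<phi> k} \<theta> - z))\<^sup>2)" for k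
      by (intro continuous_imp_integrable_real continuous_intros)
    have 5: "eventually (\<lambda>k. (LINT \<theta>|lebesgue_on {\<alpha>..\<beta>}. (cmod (lacunary_sum a {..<\<phi> k} \<theta> - z))\<^sup>2) \<le> B) sequentially"
      unfolding eventually_sequentially
      using bound strict_mono_imp_increasing[OF \<phi>] order_trans by blast
    show "integrable (lebesgue_on {\<alpha>..\<beta>}) (\<lambda>\<theta>. (cmod (u \<theta> - z))\<^sup>2)"
      "(LINT \<theta>|lebesgue_on {\<alpha>..\<beta>}. (cmod (u \<theta> - z))\<^sup>2) \<le> B"
      using integral_square_le_of_AE_limit[OF 1 2 3 4 5] by blast+
  qed
  have L2: "u \<in> L2_circle"
  proof -
    have "(LINT \<theta>|lebesgue_on {0..1}. (cmod (lacunary_sum a {..<n} \<theta> - 0))\<^sup>2) \<le> K" for n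
      using integral_square_lacunary_sum_dyadic[of "{..<n}" 0 0 a] energy[of n] by simp
    then have "integrable (lebesgue_on {0..1}) (\<lambda>\<theta>. (cmod (u \<theta> - 0))\<^sup>2)" by (rule local(1))
    then show ?thesis using u_meas periodic
      by (simp add: L2_circle_def set_integrable_def integrable_restrict_space)
  qed
  obtain B where B: "0 < B" and upper: "\<forall>m::nat. \<forall>t\<ge>1. ln t \<le> real m \<longrightarrow> ?g t \<le> B * (1 + real m) powr r"
    using Psi_inv_ratio_dyadic[OF r c] by (elim exE conjE)
  obtain E where E: "0 \<le> E"
    and osc: "\<forall>\<alpha> l m n. 0 < l \<longrightarrow> 2 ^ m \<le> 1 / l \<longrightarrow> 1 / l < 2 ^ Suc m \<longrightarrow> m \<le> n \<longrightarrow>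
     (LINT \<theta>|lebesgue_on {\<alpha>..\<alpha> + l}. (cmod (lacunary_sum a {..<n} \<theta> - lacunary_sum a {..<m} \<alpha>))\<^sup>2)
       \<le> E * l / ((1 + real m) powr r)\<^sup>2"
    using partial_sum_oscillation_le[OF r decay] by (elim exE conjE)
  have "1 / ((rho (Psi c r) l)\<^sup>2 * l) *
      (LINT \<theta>:{\<alpha>..\<alpha> + l}|lebesgue. (cmod (u \<theta> - arc_avg u \<alpha> l))\<^sup>2) \<le> (B * 2 powr r)\<^sup>2 * E"
    if l: "0 < l" "l \<le> 1" for \<alpha> l
  proof -
    obtain m where m: "2 ^ m \<le> 1 / l" "1 / l < 2 ^ Suc m" using dyadic_scale[OF l] .
    let ?I = "lebesgue_on {\<alpha>..\<alpha> + l}"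
    let ?z = "lacunary_sum a {..<m} \<alpha>"
    let ?w = "(1 + real m) powr r"
    interpret finite_measure ?I by (rule finite_measure_interval)
    have bound: "(LINT \<theta>|?I. (cmod (lacunary_sum a {..<n} \<theta> - ?z))\<^sup>2) \<le> E * l / ?w\<^sup>2" if "n \<ge> m" for n
      using osc l m that by blast
    have um: "u \<in> borel_measurable ?I" using u_meas by (rule measurable_restrict_space1)
    \<comment> \<open>Adding back \<open>?z\<close> shows that \<open>u\<close> itself is square integrable on the arc.\<close>
    have "integrable ?I (\<lambda>\<theta>. (cmod (u \<theta> - ?z - (- ?z)))\<^sup>2)"
      using um by (intro square_integrable_diff_const local(1)[OF bound]) auto
    then have "integrable ?I (\<lambda>\<theta>. (cmod (u \<theta>))\<^sup>2)" by simp
    then have "(LINT \<theta>|?I. (cmod (u \<theta> - arc_avg u \<alpha> l))\<^sup>2) \<le> (LINT \<theta>|?I. (cmod (u \<theta> - ?z))\<^sup>2)"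
      using mean_minimises_square_deviation[OF um, of ?z] l
      by (simp add: arc_avg_def set_integral_interval_eq measure_restrict_space)
    also have "\<dots> \<le> E * l / ?w\<^sup>2" by (rule local(2)[OF bound])
    finally have main: "(LINT \<theta>|?I. (cmod (u \<theta> - arc_avg u \<alpha> l))\<^sup>2) \<le> E * l / ?w\<^sup>2" .
    have "?g (1 / l) \<le> B * (1 + real (Suc m)) powr r"
    proof -
      have "ln (1 / l) \<le> ln (2 ^ Suc m)" using l m by (intro ln_mono) auto
      also have "\<dots> = real (Suc m) * ln 2" by (simp add: ln_realpow del: power_Suc)
      also have "\<dots> \<le> real (Suc m) * 1" using ln_2_less_1 by (intro mult_left_mono) auto
      finally have "ln (1 / l) \<le> real (Suc m)" by simp
      moreover have "1 \<le> 1 / l" using l by simp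
      ultimately show ?thesis using upper by blast
    qed
    also have "\<dots> \<le> B * (2 * (1 + real m)) powr r"
      using B r by (intro mult_left_mono powr_mono2) auto
    also have "(2 * (1 + real m)) powr r = 2 powr r * ?w" by (rule powr_mult)
    finally have g: "?g (1 / l) \<le> B * 2 powr r * ?w" by (simp only: mult.assoc)
    have g0: "0 \<le> ?g (1 / l)" using Psi_Psi_inv(1)[OF c, of "1 / l"] l by simp
    have rho: "rho (Psi c r) l = 1 / ?g (1 / l)" by (simp add: rho_def inverse_eq_divide)
    have "1 / ((rho (Psi c r) l)\<^sup>2 * l) * (LINT \<theta>|?I. (cmod (u \<theta> - arc_avg u \<alpha> l))\<^sup>2)
        \<le> (?g (1 / l))\<^sup>2 / l * (E * l / ?w\<^sup>2)"
      unfolding rho using main l by (intro mult_mono) (auto simp: field_simps power_divide)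
    also have "\<dots> = (?g (1 / l))\<^sup>2 * (E / ?w\<^sup>2)" using l by simp
    also have "\<dots> \<le> (B * 2 powr r * ?w)\<^sup>2 * (E / ?w\<^sup>2)"
      using g g0 E by (intro mult_right_mono power_mono) auto
    also have "\<dots> = (B * 2 powr r)\<^sup>2 * E" by (simp add: power_mult_distrib)
    finally show ?thesis by (simp add: set_integral_interval_eq)
  qed
  then have "u \<in> BMO (rho (Psi c r))"
    using L2 unfolding BMO_def bdd_above_def by blast
  moreover have "fourier_coeff u n = 0" if "n < 0" for n
    using fourier that by (simp add: is_fourier_series_of_def lacunary_coeff_nonpos)
  ultimately have "u \<in> BMOA (rho (Psi c r))" by (simp add: BMOA_def)
  with fourier show ?thesis by blast
qed

section \<open>The equivalence\<close>

theorem corollary6: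
  fixes r c :: real and a :: "nat \<Rightarrow> complex"
  assumes "r \<ge> 0" and "admissible_shift r c"
  shows "(\<exists>u \<in> BMOA (rho (Psi c r)). is_fourier_series_of (lacunary_coeff a) u) \<longleftrightarrow>
    (SUP N\<in>{1::nat..}. ennreal ((Psi_inv (Psi c r) (real N) / real N)\<^sup>2) *
       (\<Sum>\<^sub>\<infinity>j\<in>{j::nat. ln (real N) \<le> real j}. ennreal ((cmod (a j))\<^sup>2))) < \<infinity>"
proof -
  have c: "exp 1 \<le> c"
    using assms(2) by (auto simp: admissible_shift_def split: if_splits)
  have "(\<exists>u \<in> BMOA (rho (Psi c r)). is_fourier_series_of (lacunary_coeff a) u) \<longleftrightarrow> tail_decay r a"
  proof
    assume "\<exists>u \<in> BMOA (rho (Psi c r)). is_fourier_series_of (lacunary_coeff a) u"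
    then obtain u where "u \<in> BMO (rho (Psi c r))" "is_fourier_series_of (lacunary_coeff a) u"
      by (auto simp: BMOA_def)
    then show "tail_decay r a"
      using tail_decay_if_BMO[OF assms(1) c] by (simp add: is_fourier_series_of_def lacunary_coeff_power)
  qed (rule BMOA_if_tail_decay[OF assms(1) c])
  then show ?thesis
    using weighted_tails_finite_iff_tail_decay[OF assms(1) c] by simp
qed

end
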